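(* Fix $\rho\in[-1,1]$ and $\beta=(\sigma,\tau)\in\mathbb{R}^2$. If $\sigma^2<1/2$ and $\tau\neq0$, then, as $N\to\infty$, $$\frac{\mathcal{Z}_N(\beta)-N^{1+\frac12(\sigma^2-\tau^2)+i\sigma\tau\rho}}{N^{\frac12+\sigma^2}}\;\longrightarrow\;N_{\mathbb{C}}(0,1)\qquad\text{in distribution.}$$
   Context: Let $(X_1,Y_1),(X_2,Y_2),\ldots$ be i.i.d. zero-mean bivariate real Gaussian vectors with $\mathrm{Var}\,X_k=\mathrm{Var}\,Y_k=1$ and $\mathrm{Corr}(X_k,Y_k)=\rho$. For $N\in\mathbb{N}$ put $n=\log N$ (natural logarithm) and $\mathcal{Z}_N(\beta)=\sum_{k=1}^N e^{\sqrt n(\sigma X_k+i\tau Y_k)}$. For $z\in\mathbb{C}$, $N^z=e^{nz}$. $N_{\mathbb{C}}(0,s^2)$ denotes the complex Gaussian distribution with density $z\mapsto\frac1{\pi s^2}e^{-|z/s|^2}$ with respect to Lebesgue measure on $\mathbb{C}$. *)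

theory Defs
  imports "HOL-Probability.Probability"
begin

text \<open>
  The normal law with mean \<open>m\<close> and standard deviation \<open>s\<close>. The case \<open>s = 0\<close> is the point mass
  at \<open>m\<close>, as is needed for jointly Gaussian vectors with a singular covariance matrix.
\<close>

definition normal_law :: "real \<Rightarrow> real \<Rightarrow> real measure" where
  "normal_law m s =
     (if s = 0 then return borel m else density lborel (\<lambda>x. ennreal (normal_density m s x)))"

definition gaussian_rv :: "'a measure \<Rightarrow> ('a \<Rightarrow> real) \<Rightarrow> bool" where
  "gaussian_rv M X \<longleftrightarrow>
     X \<in> borel_measurable M \<and> (\<exists>m s. 0 \<le> s \<and> distr M borel X = normal_law m s)"

text \<open>\<open>(X, Y)\<close> is a Gaussian vector iff all linear combinations of its coordinates are Gaussian.\<close>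

definition bivariate_gaussian :: "'a measure \<Rightarrow> ('a \<Rightarrow> real \<times> real) \<Rightarrow> bool" where
  "bivariate_gaussian M V \<longleftrightarrow>
     V \<in> borel_measurable M \<and>
     (\<forall>a b. gaussian_rv M (\<lambda>\<omega>. a * fst (V \<omega>) + b * snd (V \<omega>)))"

context prob_space
begin

definition covariance :: "('a \<Rightarrow> real) \<Rightarrow> ('a \<Rightarrow> real) \<Rightarrow> real" where
  "covariance X Y = expectation (\<lambda>\<omega>. (X \<omega> - expectation X) * (Y \<omega> - expectation Y))"

definition correlation :: "('a \<Rightarrow> real) \<Rightarrow> ('a \<Rightarrow> real) \<Rightarrow> real" where
  "correlation X Y = covariance X Y / (sqrt (variance X) * sqrt (variance Y))"

definition iid_vars :: "('i \<Rightarrow> 'a \<Rightarrow> 'b::topological_space) \<Rightarrow> 'i set \<Rightarrow> bool" where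
  "iid_vars V I \<longleftrightarrow>
     indep_vars (\<lambda>_. borel) V I \<and>
     (\<forall>i\<in>I. \<forall>j\<in>I. distr M borel (V i) = distr M borel (V j))"

end

text \<open>
  Weak convergence on a general topological space; \<^const>\<open>weak_conv_m\<close> only covers measures on
  the real line.
\<close>

definition weak_conv_bc ::
  "(nat \<Rightarrow> 'b::topological_space measure) \<Rightarrow> 'b measure \<Rightarrow> bool" where
  "weak_conv_bc \<mu> \<nu> \<longleftrightarrow>
     (\<forall>f :: 'b \<Rightarrow> real. continuous_on UNIV f \<and> bounded (range f) \<longrightarrow>
        (\<lambda>n. integral\<^sup>L (\<mu> n) f) \<longlonglongrightarrow> integral\<^sup>L \<nu> f)"

definition conv_in_distribution ::
  "'a measure \<Rightarrow> (nat \<Rightarrow> 'a \<Rightarrow> 'b::topological_space) \<Rightarrow> 'b measure \<Rightarrow> bool" where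
  "conv_in_distribution M Z \<nu> \<longleftrightarrow>
     (\<forall>n. Z n \<in> borel_measurable M) \<and> weak_conv_bc (\<lambda>n. distr M borel (Z n)) \<nu>"

definition complex_normal :: "real \<Rightarrow> complex measure" where
  "complex_normal s =
     density lborel (\<lambda>z. ennreal (1 / (pi * s\<^sup>2) * exp (- (cmod (z / complex_of_real s))\<^sup>2)))"

definition partition_fun ::
  "(nat \<Rightarrow> 'a \<Rightarrow> real) \<Rightarrow> (nat \<Rightarrow> 'a \<Rightarrow> real) \<Rightarrow> real \<times> real \<Rightarrow> nat \<Rightarrow> 'a \<Rightarrow> complex" where
  "partition_fun X Y \<beta> N \<omega> =
     (\<Sum>k = 1..N. exp (complex_of_real (sqrt (ln (real N))) *
        (complex_of_real (fst \<beta> * X k \<omega>) + \<i> * complex_of_real (snd \<beta> * Y k \<omega>))))"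

end

theory Submission
  imports Defs "HOL-Complex_Analysis.Conformal_Mappings" "HOL-Real_Asymp.Real_Asymp"
begin

text \<open>
  Write \<open>n = ln N\<close> and \<open>W\<^sub>k = exp (sqrt n * (\<sigma> X\<^sub>k + \<i> \<tau> Y\<^sub>k))\<close>. The subtracted term is exactly
  \<open>N E W\<^sub>1\<close>, so the normalised quantity is the row sum of a triangular array whose \<open>N\<close>-th row
  consists of \<open>N\<close> independent copies of \<open>Z = (W\<^sub>1 - E W\<^sub>1) / N powr (1/2 + \<sigma>\<^sup>2)\<close>. Three
  computations with Gaussian moments decide the limit.

  \<^item> Since \<open>\<bar>W\<^sub>1\<bar>\<^sup>2\<close> has mean \<open>N powr (2 \<sigma>\<^sup>2)\<close>, one gets
    \<open>N E \<bar>Z\<bar>\<^sup>2 = 1 - N powr (- \<sigma>\<^sup>2 - \<tau>\<^sup>2)\<close>, which tends to 1.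
  \<^item> The mean of \<open>W\<^sub>1\<^sup>2\<close> is smaller in modulus by a factor \<open>N powr (- 2 \<tau>\<^sup>2)\<close>: for \<open>\<tau> \<noteq> 0\<close> the
    phase of \<open>W\<^sub>1\<close> spreads over the whole circle. So \<open>N E Z\<^sup>2\<close> tends to 0, and the limiting
    covariance of the row sum \<open>S\<close> is isotropic, with variance \<open>\<bar>u\<bar>\<^sup>2 / 2\<close> for \<open>u \<bullet> S\<close>.
  \<^item> For \<open>p > 2\<close> the Lyapunov sum \<open>N E \<bar>Z\<bar> powr p\<close> is at most a constant times
    \<open>N powr ((p/2 - 1) * (p \<sigma>\<^sup>2 - 1))\<close>, which tends to 0 when \<open>p \<sigma>\<^sup>2 < 1\<close>. Such a \<open>p > 2\<close>
    exists precisely because \<open>\<sigma>\<^sup>2 < 1/2\<close>.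

  Three tools turn this into a proof. The means of \<open>W\<^sub>1\<close> and \<open>W\<^sub>1\<^sup>2\<close> mix a real exponent in \<open>X\<close>
  with an imaginary one in \<open>Y\<close>, while the Gaussian hypothesis speaks of real linear combinations;
  \<open>mixed_gaussian_transform\<close> bridges the gap by analytic continuation.
  \<open>iid_array_char_tendsto\<close> is Lyapunov's central limit theorem in terms of characteristic functions,
  applied to \<open>u \<bullet> Z\<close> for each fixed direction \<open>u\<close>. Finally \<open>complex_levy_continuity\<close> passes from the
  characteristic functions in all directions to weak convergence on the complex plane.
\<close>

section \<open>Gaussian laws on the real line\<close>

lemma normal_law_eq_distr_std_normal:
  assumes "0 \<le> s"
  shows "normal_law m s = distr std_normal_distribution borel (\<lambda>x. m + s * x)"
proof (cases "s = 0")
  case True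
  interpret prob_space std_normal_distribution
    by (rule prob_space_normal_density) simp
  show ?thesis using True by (simp add: normal_law_def)
next
  case False
  with assms have s: "s > 0" by simp
  interpret prob_space std_normal_distribution
    by (rule prob_space_normal_density) simp
  have "distributed std_normal_distribution lborel (\<lambda>x. x) std_normal_density"
    by (auto simp: distributed_def distr_id2)
  from normal_density_affine[OF this, of s m] s
  have "distributed std_normal_distribution lborel (\<lambda>x. m + s * x) (normal_density m s)"
    by simp
  then show ?thesis using s by (simp add: distributed_def normal_law_def cong: distr_cong)
qed

lemma std_normal_exp:
  "integrable std_normal_distribution (\<lambda>x. exp (t * x))"
  "(LINT x|std_normal_distribution. exp (t * x)) = exp (t\<^sup>2 / 2)"
proof -
  have eq: "std_normal_density x * exp (t * x) = exp (t\<^sup>2 / 2) * normal_density t 1 x" for x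
    by (simp add: normal_density_def exp_add[symmetric] field_simps power2_eq_square)
  show "integrable std_normal_distribution (\<lambda>x. exp (t * x))"
    by (subst integrable_density) (auto simp: eq)
  show "(LINT x|std_normal_distribution. exp (t * x)) = exp (t\<^sup>2 / 2)"
    by (subst integral_density) (auto simp: eq)
qed

lemma std_normal_moments:
  "(LINT x|std_normal_distribution. x) = 0" "(LINT x|std_normal_distribution. x\<^sup>2) = 1"
  using integral_std_normal_distribution_moment_odd[of 1] std_normal_distribution_even_moments(1)[of 1]
  by (simp_all only: power_one_right odd_one mult_1_right simp_thms fact_2) (simp_all add: fact_2)

text \<open>
  The affine form covers the point masses (\<open>s = 0\<close>) as well, so that every moment of a Gaussian
  variable reduces to one of the standard normal law without a case distinction.
\<close>
lemma (in prob_space) gaussian_rv_representation: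
  assumes "gaussian_rv M V"
  obtains s where "distr M borel V = distr std_normal_distribution borel (\<lambda>x. expectation V + s * x)"
    "variance V = s\<^sup>2"
proof -
  interpret S: prob_space std_normal_distribution
    by (rule prob_space_normal_density) simp
  have [measurable]: "V \<in> borel_measurable M" using assms by (simp add: gaussian_rv_def)
  obtain m s where s: "0 \<le> s" and d: "distr M borel V = distr std_normal_distribution borel (\<lambda>x. m + s * x)"
    using assms normal_law_eq_distr_std_normal by (auto simp: gaussian_rv_def)
  have *: "expectation (\<lambda>\<omega>. f (V \<omega>)) = (LINT x|std_normal_distribution. f (m + s * x))"
    if [measurable]: "f \<in> borel_measurable borel" for f :: "real \<Rightarrow> real"
    using arg_cong[OF d, of "\<lambda>M. integral\<^sup>L M f"] by (simp add: integral_distr)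
  have i: "integrable std_normal_distribution (\<lambda>x. x)"
    using integrable_std_normal_distribution_moment[of 1] by simp
  have "expectation V = (LINT x|std_normal_distribution. m + s * x)"
    by (rule *) simp
  also have "\<dots> = (LINT x|std_normal_distribution. m) + (LINT x|std_normal_distribution. s * x)"
    using i by (intro Bochner_Integration.integral_add S.integrable_const integrable_mult_right)
  also have "\<dots> = m"
    by (simp only: lebesgue_integral_const S.prob_space integral_mult_right_zero std_normal_moments) simp
  finally have m: "expectation V = m" .
  have "variance V = (LINT x|std_normal_distribution. (m + s * x - m)\<^sup>2)"
    unfolding m by (rule *) simp
  also have "\<dots> = s\<^sup>2"
    by (simp only: add_diff_cancel_left' power_mult_distrib integral_mult_right_zero std_normal_moments mult_1_right)
  finally have "variance V = s\<^sup>2" .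
  with d m that show ?thesis by blast
qed

lemma (in prob_space) gaussian_rv_exp:
  assumes "gaussian_rv M V"
  shows "integrable M (\<lambda>\<omega>. exp (V \<omega>))"
    "expectation (\<lambda>\<omega>. exp (V \<omega>)) = exp (expectation V + variance V / 2)"
proof -
  obtain s where d: "distr M borel V = distr std_normal_distribution borel (\<lambda>x. expectation V + s * x)"
    and v: "variance V = s\<^sup>2" by (rule gaussian_rv_representation[OF assms])
  have [measurable]: "V \<in> borel_measurable M" using assms by (simp add: gaussian_rv_def)
  have "integrable (distr M borel V) exp"
    unfolding d by (subst integrable_distr_eq) (auto simp: exp_add std_normal_exp)
  then show "integrable M (\<lambda>\<omega>. exp (V \<omega>))" by (simp add: integrable_distr_eq)
  have "expectation (\<lambda>\<omega>. exp (V \<omega>)) = integral\<^sup>L (distr M borel V) exp"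
    by (simp add: integral_distr)
  also have "\<dots> = exp (expectation V + variance V / 2)"
    unfolding d v by (subst integral_distr) (auto simp: exp_add std_normal_exp)
  finally show "expectation (\<lambda>\<omega>. exp (V \<omega>)) = exp (expectation V + variance V / 2)" .
qed

lemma (in prob_space) gaussian_rv_iexp:
  assumes "gaussian_rv M V"
  shows "expectation (\<lambda>\<omega>. iexp (V \<omega>)) = iexp (expectation V) * exp (- (variance V / 2))"
proof -
  obtain s where d: "distr M borel V = distr std_normal_distribution borel (\<lambda>x. expectation V + s * x)"
    and v: "variance V = s\<^sup>2" by (rule gaussian_rv_representation[OF assms])
  have [measurable]: "V \<in> borel_measurable M" using assms by (simp add: gaussian_rv_def)
  have "expectation (\<lambda>\<omega>. iexp (V \<omega>)) = integral\<^sup>L (distr M borel V) iexp"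
    by (simp add: integral_distr)
  also have "\<dots> = iexp (expectation V) * (CLINT x|std_normal_distribution. iexp (s * x))"
    unfolding d by (subst integral_distr) (auto simp: exp_add distrib_left)
  also have "(CLINT x|std_normal_distribution. iexp (s * x)) = exp (- (variance V / 2))"
    using fun_cong[OF char_std_normal_distribution, of s] unfolding char_def v 
    by (simp add: exp_of_real)
  finally show ?thesis .
qed

lemma (in prob_space) gaussian_rv_square_integrable:
  assumes "gaussian_rv M V"
  shows "integrable M (\<lambda>\<omega>. (V \<omega>)\<^sup>2)"
proof -
  obtain s where d: "distr M borel V = distr std_normal_distribution borel (\<lambda>x. expectation V + s * x)"
    and v: "variance V = s\<^sup>2" by (rule gaussian_rv_representation[OF assms])
  interpret S: prob_space std_normal_distribution
    by (rule prob_space_normal_density) simp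
  have [measurable]: "V \<in> borel_measurable M" using assms by (simp add: gaussian_rv_def)
  have i: "integrable std_normal_distribution (\<lambda>x. x)"
    using integrable_std_normal_distribution_moment[of 1] by simp
  have i2: "integrable std_normal_distribution (\<lambda>x. x\<^sup>2)"
    by (rule integrable_std_normal_distribution_moment)
  have "integrable (distr M borel V) (\<lambda>x. x\<^sup>2)"
    unfolding d
    by (subst integrable_distr_eq)
       (simp_all only: power2_sum power_mult_distrib mult.assoc[symmetric],
        auto intro!: Bochner_Integration.integrable_add integrable_mult_right i i2)
  then show ?thesis by (simp add: integrable_distr_eq)
qed

lemma prob_space_normal_law: "0 \<le> s \<Longrightarrow> prob_space (normal_law m s)"
  by (auto simp: normal_law_def prob_space_return prob_space_normal_density)

lemma sets_normal_law [measurable_cong]: "sets (normal_law m s) = sets borel"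
  by (simp add: normal_law_def)

lemma char_normal_law:
  assumes "0 \<le> s"
  shows "char (normal_law 0 s) t = of_real (exp (- (s * t)\<^sup>2 / 2))"
  using fun_cong[OF char_std_normal_distribution, of "t * s"] assms unfolding char_def
  by (simp add: normal_law_eq_distr_std_normal integral_distr mult_ac)

section \<open>The Laplace--Fourier transform of a Gaussian pair\<close>

text \<open>
  Expanding the exponential and integrating term by term gives an everywhere convergent power series
  in \<open>z\<close>. The interchange is justified by the integrable majorant
  \<open>exp (\<bar>z\<bar> X) + exp (- \<bar>z\<bar> X)\<close>, which dominates \<open>exp \<bar>z X\<bar>\<close> and hence all partial sums.
\<close>
lemma (in prob_space) holomorphic_integral_exp:
  fixes X :: "'a \<Rightarrow> real" and g :: "'a \<Rightarrow> complex"
  assumes exp_integrable: "\<And>c. integrable M (\<lambda>\<omega>. exp (c * X \<omega>))"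
    and [measurable]: "X \<in> borel_measurable M" "g \<in> borel_measurable M"
    and g: "\<And>\<omega>. norm (g \<omega>) \<le> 1"
  shows "(\<lambda>z. CLINT \<omega>|M. exp (z * X \<omega>) * g \<omega>) holomorphic_on UNIV"
proof -
  define a where "a k = (CLINT \<omega>|M. of_real (X \<omega> ^ k / fact k) * g \<omega>)" for k
  have "(\<lambda>k. a k * z ^ k) sums (CLINT \<omega>|M. exp (z * X \<omega>) * g \<omega>)" for z :: complex
  proof -
    let ?f = "\<lambda>k \<omega>. (z * X \<omega>) ^ k /\<^sub>R fact k * g \<omega>"
    define G where "G \<omega> = exp (norm z * X \<omega>) + exp (- norm z * X \<omega>)" for \<omega>
    have G: "integrable M G"
      unfolding G_def by (intro Bochner_Integration.integrable_add exp_integrable)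
    have sums: "(\<lambda>k. (norm z * \<bar>X \<omega>\<bar>) ^ k /\<^sub>R fact k) sums exp (norm z * \<bar>X \<omega>\<bar>)" for \<omega>
      by (rule exp_converges)
    have bound: "norm (?f k \<omega>) \<le> (norm z * \<bar>X \<omega>\<bar>) ^ k /\<^sub>R fact k" for k \<omega>
      using mult_left_mono[OF g, of "(norm z * \<bar>X \<omega>\<bar>) ^ k / fact k" \<omega>]
      by (simp add: norm_mult norm_power power_mult_distrib field_simps norm_divide)
    have expG: "exp (norm z * \<bar>X \<omega>\<bar>) \<le> G \<omega>" for \<omega>
      by (auto simp: G_def abs_if)
    have partial: "(\<Sum>k<n. norm (?f k \<omega>)) \<le> G \<omega>" for n \<omega>
    proof -
      have "(\<Sum>k<n. norm (?f k \<omega>)) \<le> (\<Sum>k<n. (norm z * \<bar>X \<omega>\<bar>) ^ k /\<^sub>R fact k)"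
        by (intro sum_mono bound)
      also have "\<dots> \<le> exp (norm z * \<bar>X \<omega>\<bar>)"
        using sums[of \<omega>] by (subst sums_unique[OF sums], intro sum_le_suminf) (auto simp: sums_iff)
      also have "\<dots> \<le> G \<omega>" by (rule expG)
      finally show ?thesis .
    qed
    have int: "integrable M (?f k)" for k
    proof (rule Bochner_Integration.integrable_bound[OF G])
      show "AE \<omega> in M. norm (?f k \<omega>) \<le> norm (G \<omega>)"
      proof (rule AE_I2)
        fix \<omega>
        have "norm (?f k \<omega>) \<le> (\<Sum>j<Suc k. norm (?f j \<omega>))"
          by (rule member_le_sum) auto
        also have "\<dots> \<le> G \<omega>" by (rule partial)
        finally show "norm (?f k \<omega>) \<le> norm (G \<omega>)" by simp
      qed
    qed measurable
    have "(\<lambda>k. integral\<^sup>L M (?f k)) sums (CLINT \<omega>|M. (\<Sum>k. ?f k \<omega>))"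
    proof (rule sums_integral[OF int])
      show "AE \<omega> in M. summable (\<lambda>k. norm (?f k \<omega>))"
      proof (rule AE_I2)
        fix \<omega>
        have "summable (\<lambda>k. (norm z * \<bar>X \<omega>\<bar>) ^ k /\<^sub>R fact k)"
          using sums by (rule sums_summable)
        then show "summable (\<lambda>k. norm (?f k \<omega>))"
        proof (rule summable_comparison_test'[where N = 0])
          show "norm (norm (?f k \<omega>)) \<le> (norm z * \<bar>X \<omega>\<bar>) ^ k /\<^sub>R fact k" for k
            by (simp only: real_norm_def abs_norm_cancel, rule bound)
        qed
      qed
      show "summable (\<lambda>k. LINT \<omega>|M. norm (?f k \<omega>))"
      proof (rule bounded_imp_summable)
        show "(\<Sum>k\<le>n. LINT \<omega>|M. norm (?f k \<omega>)) \<le> integral\<^sup>L M G" for n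
        proof -
          have "(\<Sum>k\<le>n. LINT \<omega>|M. norm (?f k \<omega>)) = (LINT \<omega>|M. (\<Sum>k\<le>n. norm (?f k \<omega>)))"
            by (intro Bochner_Integration.integral_sum[symmetric] integrable_norm int)
          also have "\<dots> \<le> integral\<^sup>L M G"
          proof (rule integral_mono)
            show "(\<Sum>k\<le>n. norm (?f k \<omega>)) \<le> G \<omega>" for \<omega>
              using partial[of \<omega> "Suc n"] by (simp only: lessThan_Suc_atMost)
          qed (intro Bochner_Integration.integrable_sum integrable_norm int, rule G)
          finally show ?thesis .
        qed
      qed auto
    qed
    moreover have "(\<Sum>k. ?f k \<omega>) = exp (z * X \<omega>) * g \<omega>" for \<omega>
      using sums_mult2[OF exp_converges[of "z * of_real (X \<omega>)"], of "g \<omega>"] by (simp add: sums_iff)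
    moreover have "integral\<^sup>L M (?f k) = a k * z ^ k" for k
      unfolding a_def
      by (subst integral_mult_left_zero[symmetric])
         (auto intro!: Bochner_Integration.integral_cong simp: power_mult_distrib scaleR_conv_of_real field_simps)
    ultimately show ?thesis by simp
  qed
  then have "(\<lambda>z. CLINT \<omega>|M. exp (z * X \<omega>) * g \<omega>) holomorphic_on ball 0 r" for r
    by (intro power_series_holomorphic[of 0 r a]) auto
  then have "(\<lambda>z. CLINT \<omega>|M. exp (z * X \<omega>) * g \<omega>) holomorphic_on (\<Union>r. ball 0 r)"
    by (subst holomorphic_on_UN_open) auto
  moreover have "(\<Union>r. ball 0 r) = (UNIV :: complex set)"
    by (auto simp: gt_ex)
  ultimately show ?thesis by simp
qed

text \<open>
  For purely imaginary \<open>z\<close> the left-hand side is the characteristic function of the pair, so both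
  sides agree there; both are entire in \<open>z\<close>, hence they agree everywhere.
\<close>
lemma (in prob_space) mixed_gaussian_transform:
  fixes X Y :: "'a \<Rightarrow> real"
  assumes exp_integrable: "\<And>c. integrable M (\<lambda>\<omega>. exp (c * X \<omega>))"
    and [measurable]: "X \<in> borel_measurable M" "Y \<in> borel_measurable M"
    and char: "\<And>a. expectation (\<lambda>\<omega>. iexp (a * X \<omega> + b * Y \<omega>)) = of_real (exp (- (a\<^sup>2 + b\<^sup>2 + 2 * a * b * \<rho>) / 2))"
  shows "expectation (\<lambda>\<omega>. exp (z * of_real (X \<omega>) + \<i> * of_real (b * Y \<omega>)))
         = exp (z\<^sup>2 / 2 + \<i> * z * of_real (b * \<rho>) - of_real (b\<^sup>2 / 2))"
proof -
  define F where "F z = (CLINT \<omega>|M. exp (z * X \<omega>) * iexp (b * Y \<omega>))" for z :: complex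
  define G where "G z = exp (z\<^sup>2 / 2 + \<i> * z * of_real (b * \<rho>) - of_real (b\<^sup>2 / 2))" for z :: complex
  have F: "F holomorphic_on UNIV"
    unfolding F_def by (intro holomorphic_integral_exp exp_integrable) auto
  have G: "G holomorphic_on UNIV"
    unfolding G_def by (intro holomorphic_intros) auto
  have imag: "F (\<i> * of_real a) = G (\<i> * of_real a)" for a
  proof -
    have "F (\<i> * of_real a) = expectation (\<lambda>\<omega>. iexp (a * X \<omega> + b * Y \<omega>))"
      unfolding F_def by (intro Bochner_Integration.integral_cong) (auto simp: exp_add[symmetric] algebra_simps)
    also have "\<dots> = G (\<i> * of_real a)"
      unfolding char exp_of_real[symmetric] G_def by (intro arg_cong[of _ _ exp]) (simp add: power_mult_distrib field_simps)
    finally show ?thesis .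
  qed
  have "0 islimpt range (\<lambda>a. \<i> * of_real a)"
  proof (subst islimpt_sequential, intro exI conjI allI)
    show "\<i> * of_real (1 / real (Suc n)) \<in> range (\<lambda>a. \<i> * of_real a) - {0}" for n
      by (auto simp del: of_real_divide)
    show "(\<lambda>n. \<i> * of_real (1 / real (Suc n))) \<longlonglongrightarrow> 0"
      by (intro tendsto_mult_right_zero tendsto_of_real[THEN tendsto_eq_rhs, OF lim_inverse_n'[THEN LIMSEQ_Suc]]) simp
  qed
  then have "F z - G z = 0"
    by (rule analytic_continuation[of "\<lambda>z. F z - G z" UNIV "range (\<lambda>a. \<i> * of_real a)" 0 z, rotated 5])
       (use imag in \<open>auto intro!: holomorphic_intros F G\<close>)
  then show ?thesis by (simp add: F_def G_def exp_add mult.commute)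
qed

section \<open>The standard complex normal law\<close>

lemma borel_measurable_Complex [measurable (raw)]:
  "f \<in> borel_measurable M \<Longrightarrow> g \<in> borel_measurable M \<Longrightarrow> (\<lambda>x. Complex (f x) (g x)) \<in> borel_measurable M"
  by (simp add: borel_measurable_complex_iff)

lemma lborel_complex: "lborel = distr (lborel \<Otimes>\<^sub>M lborel) borel (\<lambda>(x, y). Complex x y)"
proof (rule lborel_eqI)
  fix l u :: complex
  assume le: "\<And>b. b \<in> Basis \<Longrightarrow> l \<bullet> b \<le> u \<bullet> b"
  have le: "Re l \<le> Re u" "Im l \<le> Im u"
    using le[of 1] le[of \<i>] by (auto simp: Basis_complex_def)
  have "(\<lambda>(x, y). Complex x y) -` box l u \<inter> space (lborel \<Otimes>\<^sub>M lborel)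
      = {Re l<..<Re u} \<times> {Im l<..<Im u}"
    by (auto simp: in_box_complex_iff space_pair_measure)
  then show "emeasure (distr (lborel \<Otimes>\<^sub>M lborel) borel (\<lambda>(x, y). Complex x y)) (box l u)
      = (\<Prod>b\<in>Basis. (u - l) \<bullet> b)"
    using le by (subst emeasure_distr)
      (auto simp: lborel.emeasure_pair_measure_Times Basis_complex_def ennreal_mult'')
qed simp

text \<open>
  The density \<open>exp (- \<bar>z\<bar>\<^sup>2) / pi\<close> factors into two centred normal densities of variance \<open>1/2\<close>.
\<close>
lemma complex_normal_1_eq:
  "complex_normal 1 =
     distr (normal_law 0 (1 / sqrt 2) \<Otimes>\<^sub>M normal_law 0 (1 / sqrt 2)) borel (\<lambda>(x, y). Complex x y)"
proof -
  let ?d = "\<lambda>x. ennreal (normal_density 0 (1 / sqrt 2) x)"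
  have [measurable]: "(\<lambda>(x, y). Complex x y) \<in> borel_measurable (lborel \<Otimes>\<^sub>M lborel)"
    by measurable
  have d: "?d x * ?d y = ennreal (1 / (pi * 1\<^sup>2) * exp (- (cmod (Complex x y / complex_of_real 1))\<^sup>2))" for x y
    by (subst ennreal_mult[symmetric]) (auto simp: normal_density_def power_divide cmod_power2 exp_add[symmetric])
  have "complex_normal 1 = density (distr (lborel \<Otimes>\<^sub>M lborel) borel (\<lambda>(x, y). Complex x y))
      (\<lambda>z. ennreal (1 / (pi * 1\<^sup>2) * exp (- (cmod (z / complex_of_real 1))\<^sup>2)))"
    unfolding complex_normal_def lborel_complex[symmetric] by simp
  also have "\<dots> = distr (density (lborel \<Otimes>\<^sub>M lborel) (\<lambda>(x, y). ?d x * ?d y)) borel (\<lambda>(x, y). Complex x y)"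
    by (subst density_distr) (auto simp: d case_prod_unfold)
  also have "density (lborel \<Otimes>\<^sub>M lborel) (\<lambda>(x, y). ?d x * ?d y) = density lborel ?d \<Otimes>\<^sub>M density lborel ?d"
    using prob_space_normal_density[of "1 / sqrt 2" 0]
    by (subst pair_measure_density) (auto intro: prob_space_imp_sigma_finite sigma_finite_lborel)
  finally show ?thesis by (simp add: normal_law_def)
qed

lemma prob_space_complex_normal: "prob_space (complex_normal 1)"
proof -
  interpret N: prob_space "normal_law 0 (1 / sqrt 2)" by (rule prob_space_normal_law) simp
  interpret P: pair_prob_space "normal_law 0 (1 / sqrt 2)" "normal_law 0 (1 / sqrt 2)" ..
  show ?thesis unfolding complex_normal_1_eq
    by (rule P.prob_space_distr) measurable
qed

lemma char_complex_normal:
  "(CLINT z|complex_normal 1. iexp (u \<bullet> z)) = of_real (exp (- (cmod u)\<^sup>2 / 4))"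
proof -
  let ?N = "normal_law 0 (1 / sqrt 2)"
  interpret N: prob_space ?N by (rule prob_space_normal_law) simp
  interpret P: pair_prob_space ?N ?N ..
  have [measurable]: "(\<lambda>(x, y). Complex x y) \<in> borel_measurable (?N \<Otimes>\<^sub>M ?N)"
    by measurable
  let ?f = "\<lambda>z. iexp (u \<bullet> (case z of (x, y) \<Rightarrow> Complex x y))"
  have int: "integrable (?N \<Otimes>\<^sub>M ?N) ?f"
    by (rule P.integrable_const_bound[of _ 1]) auto
  have "(CLINT z|complex_normal 1. iexp (u \<bullet> z)) = integral\<^sup>L (?N \<Otimes>\<^sub>M ?N) ?f"
    unfolding complex_normal_1_eq by (subst integral_distr) auto
  also have "\<dots> = (CLINT x|?N. CLINT y|?N. ?f (x, y))"
    by (rule P.integral_fst'[OF int, symmetric])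
  also have "\<dots> = char ?N (Re u) * char ?N (Im u)"
    by (simp add: char_def inner_complex_def exp_add distrib_left)
  also have "\<dots> = of_real (exp (- (cmod u)\<^sup>2 / 4))"
    by (simp add: char_normal_law exp_add[symmetric] power_divide cmod_power2 add_divide_distrib flip: of_real_mult)
  finally show ?thesis .
qed

section \<open>Levy continuity in the plane\<close>

text \<open>
  Finite linear combinations of the characters \<open>z \<mapsto> exp (\<i> (u \<bullet> z))\<close>: by linearity, convergence of
  characteristic functions is convergence of the integrals of these functions. Sums of arbitrary
  real frequencies \<open>u\<close> are allowed, so they form an algebra for every scale \<open>L\<close> used below.
\<close>
inductive trig_polynomial :: "(complex \<Rightarrow> complex) \<Rightarrow> bool" where
  monomial: "trig_polynomial (\<lambda>z. c * iexp (u \<bullet> z))"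
| add: "trig_polynomial f \<Longrightarrow> trig_polynomial g \<Longrightarrow> trig_polynomial (\<lambda>z. f z + g z)"

lemma trig_polynomial_const: "trig_polynomial (\<lambda>z. c)"
  using trig_polynomial.monomial[of c 0] by simp

lemma trig_polynomial_mult:
  assumes "trig_polynomial f" "trig_polynomial g"
  shows "trig_polynomial (\<lambda>z. f z * g z)"
  using assms(1)
proof induction
  case (monomial c u)
  from assms(2) show ?case
  proof induction
    case (monomial d v)
    have "(\<lambda>z. c * iexp (u \<bullet> z) * (d * iexp (v \<bullet> z))) = (\<lambda>z. (c * d) * iexp ((u + v) \<bullet> z))"
      by (simp add: inner_add_left exp_add distrib_left mult_ac)
    then show ?case using trig_polynomial.monomial[of "c * d" "u + v"] by simp
  next
    case (add f g)
    then show ?case using trig_polynomial.add by (simp add: distrib_left)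
  qed
next
  case (add f h)
  then show ?case using trig_polynomial.add by (simp add: distrib_right)
qed

lemma trig_polynomial_sin: "trig_polynomial (\<lambda>z. of_real (sin (u \<bullet> z)))"
proof -
  have "(\<lambda>z. of_real (sin (u \<bullet> z)) :: complex)
      = (\<lambda>z. (1 / (2 * \<i>)) * iexp (u \<bullet> z) + (- 1 / (2 * \<i>)) * iexp ((- u) \<bullet> z))"
    by (simp add: fun_eq_iff sin_of_real[symmetric] sin_exp_eq field_simps)
  then show ?thesis
    using trig_polynomial.add[OF trig_polynomial.monomial trig_polynomial.monomial] by metis
qed

lemma trig_polynomial_bounded_continuous:
  assumes "trig_polynomial f"
  shows "(\<exists>B. \<forall>z. norm (f z) \<le> B) \<and> continuous_on UNIV f"
  using assms
proof induction
  case (monomial c u)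
  then show ?case by (auto intro!: exI[of _ "norm c"] continuous_intros simp: norm_mult)
next
  case (add f g)
  then obtain A B where "\<And>z. norm (f z) \<le> A" "\<And>z. norm (g z) \<le> B" by metis
  then have "norm (f z + g z) \<le> A + B" for z
    by (metis norm_triangle_mono)
  then show ?case using add by (auto intro!: continuous_intros)
qed

lemma trig_polynomial_integrable:
  assumes "trig_polynomial f" "prob_space \<mu>" "sets \<mu> = sets borel"
  shows "integrable \<mu> f"
proof -
  interpret prob_space \<mu> by fact
  have [measurable_cong]: "sets \<mu> = sets borel" by fact
  obtain B where B: "\<And>z. norm (f z) \<le> B" and f: "continuous_on UNIV f"
    using trig_polynomial_bounded_continuous[OF assms(1)] by auto
  have [measurable]: "f \<in> borel_measurable borel" by (rule borel_measurable_continuous_onI[OF f])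
  show ?thesis by (rule integrable_const_bound[of _ B]) (auto simp: B)
qed

lemma trig_polynomial_integral_tendsto:
  assumes "trig_polynomial f"
    and \<mu>: "\<And>n. prob_space (\<mu> n)" "\<And>n. sets (\<mu> n) = sets borel"
    and \<nu>: "prob_space \<nu>" "sets \<nu> = sets borel"
    and char: "\<And>u. (\<lambda>n. CLINT z|\<mu> n. iexp (u \<bullet> z)) \<longlonglongrightarrow> (CLINT z|\<nu>. iexp (u \<bullet> z))"
  shows "(\<lambda>n. integral\<^sup>L (\<mu> n) f) \<longlonglongrightarrow> integral\<^sup>L \<nu> f"
  using assms(1)
proof induction
  case (monomial c u)
  then show ?case by (simp add: tendsto_mult char)
next
  case (add f g)
  then show ?case
    using trig_polynomial_integrable[OF _ \<mu>] trig_polynomial_integrable[OF _ \<nu>] by (simp add: tendsto_add)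
qed

lemma trig_polynomial_polynomial_of_sines:
  assumes "real_polynomial_function P"
  shows "trig_polynomial (\<lambda>z. of_real (P (Complex (sin (Re z / L)) (sin (Im z / L)))))"
  using assms
proof induction
  case (linear f)
  interpret f: bounded_linear f by fact
  have "f (Complex a b) = a * f 1 + b * f \<i>" for a b
  proof -
    have "Complex a b = a *\<^sub>R 1 + b *\<^sub>R \<i>" by (simp add: complex_eq_iff)
    then show ?thesis by (simp add: f.add f.scaleR)
  qed
  then have eq: "(\<lambda>z. complex_of_real (f (Complex (sin (Re z / L)) (sin (Im z / L)))))
      = (\<lambda>z. of_real (sin (of_real (1 / L) \<bullet> z)) * of_real (f 1) + of_real (sin ((\<i> * of_real (1 / L)) \<bullet> z)) * of_real (f \<i>))"
    by (simp add: inner_complex_def)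
  show ?case unfolding eq
    by (intro trig_polynomial.add trig_polynomial_mult trig_polynomial_const trig_polynomial_sin)
qed (auto intro: trig_polynomial_const trig_polynomial.add trig_polynomial_mult)

text \<open>
  A uniform approximation on a square would be useless if it were large outside of it. The substitution
  \<open>w = (sin (x / L), sin (y / L))\<close> avoids this: \<open>w\<close> always stays in \<open>[-1, 1]\<^sup>2\<close>, and on
  \<open>\<bar>x\<bar>, \<bar>y\<bar> \<le> L\<close> it determines \<open>(x, y)\<close> through \<open>arcsin\<close>. A polynomial in \<open>w\<close> that is uniformly
  close to \<open>f (L arcsin w)\<close> on \<open>[-1, 1]\<^sup>2\<close> is therefore a trigonometric polynomial in \<open>(x, y)\<close> that is close
  to \<open>f\<close> on the square and bounded by \<open>B + e\<close> on the whole plane.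
\<close>
lemma bounded_trig_polynomial_approximation:
  fixes f :: "complex \<Rightarrow> real"
  assumes f: "continuous_on UNIV f" and B: "\<And>z. \<bar>f z\<bar> \<le> B" and "0 < L" "0 < e"
  obtains T :: "complex \<Rightarrow> real" where "trig_polynomial (\<lambda>z. of_real (T z))"
    "\<And>z. \<bar>T z\<bar> \<le> B + e" "\<And>z. \<bar>Re z\<bar> \<le> L \<Longrightarrow> \<bar>Im z\<bar> \<le> L \<Longrightarrow> \<bar>f z - T z\<bar> \<le> e"
proof -
  let ?S = "cbox (Complex (-1) (-1)) (Complex 1 1)"
  define g where "g w = f (Complex (L * arcsin (Re w)) (L * arcsin (Im w)))" for w
  have "continuous_on ?S (\<lambda>w. Complex (L * arcsin (Re w)) (L * arcsin (Im w)))"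
    unfolding Complex_eq by (intro continuous_intros) (auto simp: in_cbox_complex_iff)
  then have g: "continuous_on ?S g"
    unfolding g_def by (rule continuous_on_compose2[OF f]) simp
  obtain P where P: "real_polynomial_function P" and Pg: "\<And>w. w \<in> ?S \<Longrightarrow> \<bar>g w - P w\<bar> < e"
    using Stone_Weierstrass_real_polynomial_function[OF compact_cbox g \<open>0 < e\<close>] by metis
  let ?s = "\<lambda>z. Complex (sin (Re z / L)) (sin (Im z / L))"
  have S: "?s z \<in> ?S" for z by (auto simp: in_cbox_complex_iff)
  have arcsin: "L * arcsin (sin (x / L)) = x" if "\<bar>x\<bar> \<le> L" for x
  proof -
    have "\<bar>x / L\<bar> \<le> 1" using that \<open>0 < L\<close> by simp
    then have "- (pi / 2) \<le> x / L \<and> x / L \<le> pi / 2" using pi_gt3 by linarith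
    then show ?thesis using \<open>0 < L\<close> by (simp add: arcsin_sin)
  qed
  show ?thesis
  proof (rule that[of "\<lambda>z. P (?s z)"])
    show "trig_polynomial (\<lambda>z. of_real (P (?s z)))"
      by (rule trig_polynomial_polynomial_of_sines[OF P])
    show "\<bar>P (?s z)\<bar> \<le> B + e" for z
      using Pg[OF S[of z]] B[of "Complex (L * arcsin (Re (?s z))) (L * arcsin (Im (?s z)))"]
      unfolding g_def by linarith
    show "\<bar>f z - P (?s z)\<bar> \<le> e" if "\<bar>Re z\<bar> \<le> L" "\<bar>Im z\<bar> \<le> L" for z
      using Pg[OF S[of z]] that by (simp add: g_def arcsin)
  qed
qed

text \<open>
  A continuous stand-in for the indicator of the tail \<open>\<bar>x\<bar> > R\<close>, so that weak convergence of the
  one-dimensional marginals applies to it for every \<open>R\<close>.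
\<close>
definition tail_ramp :: "real \<Rightarrow> real \<Rightarrow> real" where
  "tail_ramp R x = min 1 (max 0 (\<bar>x\<bar> - R))"

lemma tail_ramp_bounds: "0 \<le> tail_ramp R x" "tail_ramp R x \<le> 1"
  by (auto simp: tail_ramp_def)

lemma continuous_tail_ramp [continuous_intros]:
  "continuous_on A f \<Longrightarrow> continuous_on A (\<lambda>x. tail_ramp R (f x))"
  unfolding tail_ramp_def by (intro continuous_intros)

lemma measurable_tail_ramp [measurable]: "tail_ramp R \<in> borel_measurable borel"
  unfolding tail_ramp_def by measurable

lemma tail_ramp_eq_0: "\<bar>x\<bar> \<le> R \<Longrightarrow> tail_ramp R x = 0"
  by (simp add: tail_ramp_def)

lemma tail_ramp_eq_1: "R + 1 \<le> \<bar>x\<bar> \<Longrightarrow> tail_ramp R x = 1"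
  by (simp add: tail_ramp_def)

lemma small_tail_ramp_integral:
  fixes X :: "'a \<Rightarrow> real"
  assumes "prob_space \<nu>" and [measurable]: "X \<in> borel_measurable \<nu>" and "0 < d"
  shows "\<forall>\<^sub>F k in sequentially. (LINT z|\<nu>. tail_ramp (real k) (X z)) < d"
proof -
  interpret prob_space \<nu> by fact
  have "(\<lambda>k. LINT z|\<nu>. tail_ramp (real k) (X z)) \<longlonglongrightarrow> (LINT z|\<nu>. 0)"
  proof (rule integral_dominated_convergence[where w = "\<lambda>_. 1"])
    show "AE z in \<nu>. (\<lambda>k. tail_ramp (real k) (X z)) \<longlonglongrightarrow> 0"
    proof (rule AE_I2, rule tendsto_eventually)
      fix z
      obtain k0 where "\<bar>X z\<bar> \<le> real k0" using real_arch_simple by blast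
      then show "\<forall>\<^sub>F k in sequentially. tail_ramp (real k) (X z) = 0"
        by (intro eventually_sequentiallyI[of k0]) (auto intro!: tail_ramp_eq_0)
    qed
  qed (auto simp: tail_ramp_bounds)
  then show ?thesis using \<open>0 < d\<close> by (intro order_tendstoD(2)) auto
qed

text \<open>
  This is where tightness comes from: characteristic functions of the marginals are restrictions of
  those in the plane, so the continuity theorem on the line makes the tails of the marginals
  converge to the tails of the limit.
\<close>
lemma tail_ramp_integral_tendsto:
  fixes \<mu> :: "nat \<Rightarrow> complex measure"
  assumes \<mu>: "\<And>n. prob_space (\<mu> n)" "\<And>n. sets (\<mu> n) = sets borel"
    and \<nu>: "prob_space \<nu>" "sets \<nu> = sets borel"
    and char: "\<And>u. (\<lambda>n. CLINT z|\<mu> n. iexp (u \<bullet> z)) \<longlonglongrightarrow> (CLINT z|\<nu>. iexp (u \<bullet> z))"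
  shows "(\<lambda>n. LINT z|\<mu> n. tail_ramp R (e \<bullet> z)) \<longlonglongrightarrow> (LINT z|\<nu>. tail_ramp R (e \<bullet> z))"
proof -
  note [measurable_cong] = \<mu>(2) \<nu>(2)
  have real_distr: "real_distribution (distr \<mu>' borel ((\<bullet>) e))"
    if "prob_space \<mu>'" "sets \<mu>' = sets borel" for \<mu>'
    using that by (intro prob_space.real_distribution_distr) (auto simp: measurable_cong_sets[OF that(2) refl])
  have charD: "char (distr \<mu>' borel ((\<bullet>) e)) t = (CLINT z|\<mu>'. iexp ((t *\<^sub>R e) \<bullet> z))"
    if [measurable_cong]: "sets \<mu>' = sets borel" for \<mu>' t
    by (simp add: char_def integral_distr)
  have wc: "weak_conv_m (\<lambda>n. distr (\<mu> n) borel ((\<bullet>) e)) (distr \<nu> borel ((\<bullet>) e))"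
  proof (rule levy_continuity)
    show "(\<lambda>n. char (distr (\<mu> n) borel ((\<bullet>) e)) t) \<longlonglongrightarrow> char (distr \<nu> borel ((\<bullet>) e)) t" for t
      unfolding charD[OF \<mu>(2)] charD[OF \<nu>(2)] by (rule char)
  qed (intro real_distr \<mu> \<nu>)+
  have "(\<lambda>n. integral\<^sup>L (distr (\<mu> n) borel ((\<bullet>) e)) (tail_ramp R)) \<longlonglongrightarrow>
      integral\<^sup>L (distr \<nu> borel ((\<bullet>) e)) (tail_ramp R)"
  proof (rule weak_conv_imp_integral_bdd_continuous_conv[OF _ _ wc])
    show "isCont (tail_ramp R) x" for x
      using continuous_tail_ramp[of UNIV "\<lambda>x. x" R] by (simp add: continuous_on_eq_continuous_at)
    show "norm (tail_ramp R x) \<le> 1" for x by (simp add: tail_ramp_bounds)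
  qed (intro real_distr \<mu> \<nu>)+
  then show ?thesis by (simp add: integral_distr)
qed

text \<open>
  A bounded continuous \<open>f\<close> is replaced by a trigonometric polynomial \<open>T\<close> of comparable size, whose
  integrals converge by hypothesis. The error \<open>\<bar>f - T\<bar>\<close> is small on a large square and bounded
  elsewhere, so it is dominated by a function \<open>H\<close> built from ramps in the two coordinates. The
  integrals of \<open>H\<close> converge too, and in the limit they are small.
\<close>
theorem complex_levy_continuity:
  fixes \<mu> :: "nat \<Rightarrow> complex measure"
  assumes \<mu>: "\<And>n. prob_space (\<mu> n)" "\<And>n. sets (\<mu> n) = sets borel"
    and \<nu>: "prob_space \<nu>" "sets \<nu> = sets borel"
    and char: "\<And>u. (\<lambda>n. CLINT z|\<mu> n. iexp (u \<bullet> z)) \<longlonglongrightarrow> (CLINT z|\<nu>. iexp (u \<bullet> z))"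
  shows "weak_conv_bc \<mu> \<nu>"
  unfolding weak_conv_bc_def
proof (intro allI impI, elim conjE)
  fix f :: "complex \<Rightarrow> real"
  assume f: "continuous_on UNIV f" and bdd: "bounded (range f)"
  interpret \<nu>: prob_space \<nu> by fact
  interpret \<mu>: prob_space "\<mu> n" for n by fact
  note [measurable_cong] = \<mu>(2) \<nu>(2)
  obtain B where B: "\<And>z. \<bar>f z\<bar> \<le> B" using bdd by (auto simp: bounded_iff)
  have "0 \<le> B" using B[of 0] by linarith
  have bounded_integrable: "integrable (\<mu> n) g \<and> integrable \<nu> g"
    if "continuous_on UNIV g" "\<And>z. \<bar>g z\<bar> \<le> C" for g :: "complex \<Rightarrow> real" and C n
  proof -
    have [measurable]: "g \<in> borel_measurable borel" by (rule borel_measurable_continuous_onI) fact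
    show ?thesis using that(2)
      by (auto intro!: \<mu>.integrable_const_bound[of _ C] \<nu>.integrable_const_bound[of _ C])
  qed
  show "(\<lambda>n. integral\<^sup>L (\<mu> n) f) \<longlonglongrightarrow> integral\<^sup>L \<nu> f"
  proof (rule LIMSEQ_I)
    fix \<epsilon> :: real assume "0 < \<epsilon>"
    \<comment> \<open>Twice the limiting error is at most \<open>2 * (d + (2 * B + 1) * 2 * d) = d * (8 * B + 6)\<close>.\<close>
    define d where "d = min 1 (\<epsilon> / (8 * B + 7))"
    have "d \<le> \<epsilon> / (8 * B + 7)" by (simp add: d_def)
    then have "d * (8 * B + 7) \<le> \<epsilon>" using \<open>0 \<le> B\<close> by (simp add: pos_le_divide_eq)
    moreover have "0 < d" "d \<le> 1" using \<open>0 < \<epsilon>\<close> \<open>0 \<le> B\<close> by (auto simp: d_def)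
    ultimately have d: "0 < d" "d \<le> 1" "d * (8 * B + 7) \<le> \<epsilon>" by auto
    have "\<forall>\<^sub>F k in sequentially. (LINT z|\<nu>. tail_ramp (real k) (1 \<bullet> z)) < d
        \<and> (LINT z|\<nu>. tail_ramp (real k) (\<i> \<bullet> z)) < d"
      using d by (intro eventually_conj small_tail_ramp_integral \<nu>.prob_space_axioms) auto
    then obtain k :: nat where "(LINT z|\<nu>. tail_ramp (real k) (1 \<bullet> z)) < d"
        "(LINT z|\<nu>. tail_ramp (real k) (\<i> \<bullet> z)) < d"
      unfolding eventually_sequentially by blast
    then obtain R :: real where R: "0 \<le> R"
        "(LINT z|\<nu>. tail_ramp R (1 \<bullet> z)) < d" "(LINT z|\<nu>. tail_ramp R (\<i> \<bullet> z)) < d"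
      by (metis of_nat_0_le_iff)
    obtain T :: "complex \<Rightarrow> real" where T: "trig_polynomial (\<lambda>z. of_real (T z))"
      and T_bound: "\<And>z. \<bar>T z\<bar> \<le> B + d"
      and T_approx: "\<And>z. \<bar>Re z\<bar> \<le> R + 1 \<Longrightarrow> \<bar>Im z\<bar> \<le> R + 1 \<Longrightarrow> \<bar>f z - T z\<bar> \<le> d"
      using bounded_trig_polynomial_approximation[OF f B, of "R + 1" d] R d by auto
    have "continuous_on UNIV (\<lambda>z. Re (of_real (T z)))"
      using trig_polynomial_bounded_continuous[OF T] by (intro continuous_intros) auto
    then have T_cont: "continuous_on UNIV T" by simp
    have T_lim: "(\<lambda>n. integral\<^sup>L (\<mu> n) T) \<longlonglongrightarrow> integral\<^sup>L \<nu> T"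
      using tendsto_Re[OF trig_polynomial_integral_tendsto[OF T \<mu> \<nu> char]] by simp
    define h where "h e z = tail_ramp R (e \<bullet> z)" for e z :: complex
    define H where "H z = d + (2 * B + d) * (h 1 z + h \<i> z)" for z
    have "integrable (\<mu> n) (h e) \<and> integrable \<nu> (h e)" for n e
      unfolding h_def
      by (rule bounded_integrable[of _ 1]) (auto simp: tail_ramp_bounds intro!: continuous_intros)
    then have h_int: "integrable (\<mu> n) (h e)" "integrable \<nu> (h e)" for n e
      by auto
    have fT_int: "integrable (\<mu> n) f" "integrable \<nu> f" "integrable (\<mu> n) T" "integrable \<nu> T" for n
      using bounded_integrable[OF f B] bounded_integrable[OF T_cont T_bound] by auto
    have H_int: "integrable (\<mu> n) H" "integrable \<nu> H" for n
      unfolding H_def using h_int by auto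
    have fTH: "\<bar>f z - T z\<bar> \<le> H z" for z
    proof (cases "\<bar>Re z\<bar> \<le> R + 1 \<and> \<bar>Im z\<bar> \<le> R + 1")
      case True
      then have "\<bar>f z - T z\<bar> \<le> d" using T_approx by simp
      also have "\<dots> \<le> H z" using \<open>0 \<le> B\<close> d by (simp add: H_def h_def tail_ramp_bounds)
      finally show ?thesis .
    next
      case False
      then have "1 \<le> h 1 z + h \<i> z"
        using tail_ramp_eq_1[of R "Re z"] tail_ramp_eq_1[of R "Im z"]
          tail_ramp_bounds[of R "Re z"] tail_ramp_bounds[of R "Im z"]
        by (auto simp: h_def inner_complex_def)
      then have h: "2 * B + d \<le> (2 * B + d) * (h 1 z + h \<i> z)"
        using \<open>0 \<le> B\<close> d(1) mult_left_mono[of 1 "h 1 z + h \<i> z" "2 * B + d"] by simp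
      have "\<bar>f z - T z\<bar> \<le> 2 * B + d" using B[of z] T_bound[of z] by linarith
      also note h
      also have "(2 * B + d) * (h 1 z + h \<i> z) \<le> H z" using d(1) by (simp add: H_def)
      finally show ?thesis .
    qed
    have compare: "\<bar>integral\<^sup>L \<mu>' f - integral\<^sup>L \<mu>' T\<bar> \<le> integral\<^sup>L \<mu>' H"
      if "integrable \<mu>' f" "integrable \<mu>' T" "integrable \<mu>' H" for \<mu>'
    proof -
      have "\<bar>integral\<^sup>L \<mu>' (\<lambda>z. f z - T z)\<bar> \<le> integral\<^sup>L \<mu>' H"
        by (rule integral_abs_bound_integral) (use that fTH in auto)
      then show ?thesis using that by simp
    qed
    have H_lim: "(\<lambda>n. integral\<^sup>L (\<mu> n) H) \<longlonglongrightarrow> integral\<^sup>L \<nu> H"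
    proof -
      have "(\<lambda>n. d + (2 * B + d) * (integral\<^sup>L (\<mu> n) (h 1) + integral\<^sup>L (\<mu> n) (h \<i>)))
          \<longlonglongrightarrow> d + (2 * B + d) * (integral\<^sup>L \<nu> (h 1) + integral\<^sup>L \<nu> (h \<i>))"
        unfolding h_def by (intro tendsto_intros tail_ramp_integral_tendsto[OF \<mu> \<nu> char])
      then show ?thesis
        unfolding H_def using h_int by (simp add: \<mu>.prob_space \<nu>.prob_space)
    qed
    have H_small: "2 * integral\<^sup>L \<nu> H < \<epsilon>"
    proof -
      have "integral\<^sup>L \<nu> H = d + (2 * B + d) * (integral\<^sup>L \<nu> (h 1) + integral\<^sup>L \<nu> (h \<i>))"
        unfolding H_def using h_int by (simp add: \<nu>.prob_space)
      also have "\<dots> \<le> d + (2 * B + 1) * (d + d)"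
        using R d \<open>0 \<le> B\<close> unfolding h_def[abs_def]
        by (intro add_mono mult_mono) (auto intro!: add_nonneg_nonneg Bochner_Integration.integral_nonneg simp: tail_ramp_bounds)
      also have "2 * \<dots> = d * (8 * B + 6)" by (simp add: algebra_simps)
      also have "\<dots> < d * (8 * B + 7)" using d by simp
      also have "\<dots> \<le> \<epsilon>" by (rule d)
      finally show ?thesis by simp
    qed
    have "(\<lambda>n. \<bar>integral\<^sup>L (\<mu> n) T - integral\<^sup>L \<nu> T\<bar> + integral\<^sup>L (\<mu> n) H + integral\<^sup>L \<nu> H)
        \<longlonglongrightarrow> \<bar>integral\<^sup>L \<nu> T - integral\<^sup>L \<nu> T\<bar> + integral\<^sup>L \<nu> H + integral\<^sup>L \<nu> H"
      by (intro tendsto_intros T_lim H_lim)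
    then have "\<forall>\<^sub>F n in sequentially.
        \<bar>integral\<^sup>L (\<mu> n) T - integral\<^sup>L \<nu> T\<bar> + integral\<^sup>L (\<mu> n) H + integral\<^sup>L \<nu> H < \<epsilon>"
      using H_small by (intro order_tendstoD(2)) auto
    then have "\<forall>\<^sub>F n in sequentially. norm (integral\<^sup>L (\<mu> n) f - integral\<^sup>L \<nu> f) < \<epsilon>"
    proof eventually_elim
      case (elim n)
      with compare[OF fT_int(1,3) H_int(1), of n] compare[OF fT_int(2,4) H_int(2)]
      show ?case by simp
    qed
    then show "\<exists>N. \<forall>n\<ge>N. norm (integral\<^sup>L (\<mu> n) f - integral\<^sup>L \<nu> f) < \<epsilon>"
      by (simp add: eventually_sequentially)
  qed
qed

section \<open>A central limit theorem for triangular arrays\<close>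

text \<open>
  The left-hand side bounds the error of the second-order expansion of a characteristic function. For
  \<open>\<sigma>\<^sup>2\<close> close to \<open>1/2\<close> only moments of order slightly above 2 are small enough, so it is traded for a
  power \<open>p\<close> that may be any number between 2 and 3.
\<close>
lemma min_quadratic_cubic_le_powr:
  fixes x p :: real
  assumes "2 < p" "p \<le> 3"
  shows "min (6 * x\<^sup>2) (\<bar>x\<bar> ^ 3) \<le> 6 * \<bar>x\<bar> powr p"
proof (cases "\<bar>x\<bar> \<le> 1")
  case True
  have "\<bar>x\<bar> ^ 3 \<le> \<bar>x\<bar> powr p"
  proof (cases "x = 0")
    case False
    then have "\<bar>x\<bar> ^ 3 = \<bar>x\<bar> powr 3" by simp
    also have "\<dots> \<le> \<bar>x\<bar> powr p" using True assms by (intro powr_mono') auto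
    finally show ?thesis .
  qed simp
  also have "\<dots> \<le> 6 * \<bar>x\<bar> powr p" by simp
  finally show ?thesis by simp
next
  case False
  then have "x\<^sup>2 = \<bar>x\<bar> powr 2" by simp
  also have "\<dots> \<le> \<bar>x\<bar> powr p" using False assms by (intro powr_mono) auto
  finally show ?thesis by simp
qed

text \<open>
  Lyapunov's theorem for row-wise identically distributed arrays. With \<open>s\<close> and \<open>q\<close> the second and
  \<open>p\<close>-th absolute moments in row \<open>N\<close>, the characteristic function \<open>\<phi>\<close> of one entry is within \<open>q\<close> of
  \<open>1 - s / 2\<close>, hence within \<open>q + \<bar>s - v / N\<bar> / 2\<close> of \<open>w = 1 - v / (2 N)\<close>. As \<open>\<phi>\<close> and \<open>w\<close> lie in the unit
  disc, their \<open>N\<close>-th powers differ by at most \<open>N\<close> times as much, and \<open>w ^ N\<close> tends to \<open>exp (- v / 2)\<close>.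
\<close>
lemma (in prob_space) iid_array_char_tendsto:
  fixes \<eta> :: "nat \<Rightarrow> nat \<Rightarrow> 'a \<Rightarrow> real" and \<xi> :: "nat \<Rightarrow> 'a \<Rightarrow> real"
  assumes indep: "\<And>N. indep_vars (\<lambda>_. borel) (\<eta> N) {1..N}"
    and ident: "\<And>N k. k \<in> {1..N} \<Longrightarrow> distr M borel (\<eta> N k) = distr M borel (\<xi> N)"
    and [measurable]: "\<And>N. \<xi> N \<in> borel_measurable M"
    and square_integrable: "\<And>N. integrable M (\<lambda>\<omega>. (\<xi> N \<omega>)\<^sup>2)"
    and mean: "\<And>N. expectation (\<xi> N) = 0"
    and p: "2 < p" "p \<le> 3"
    and powr_integrable: "\<And>N. integrable M (\<lambda>\<omega>. \<bar>\<xi> N \<omega>\<bar> powr p)"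
    and var: "(\<lambda>N. real N * expectation (\<lambda>\<omega>. (\<xi> N \<omega>)\<^sup>2)) \<longlonglongrightarrow> v"
    and lyapunov: "(\<lambda>N. real N * expectation (\<lambda>\<omega>. \<bar>\<xi> N \<omega>\<bar> powr p)) \<longlonglongrightarrow> 0"
  shows "(\<lambda>N. char (distr M borel (\<lambda>\<omega>. \<Sum>k = 1..N. \<eta> N k \<omega>)) 1) \<longlonglongrightarrow> of_real (exp (- v / 2))"
proof -
  define s where "s N = expectation (\<lambda>\<omega>. (\<xi> N \<omega>)\<^sup>2)" for N
  define q where "q N = expectation (\<lambda>\<omega>. \<bar>\<xi> N \<omega>\<bar> powr p)" for N
  define \<phi> where "\<phi> N = char (distr M borel (\<xi> N)) 1" for N
  define w where "w N = 1 + (- v / 2) / real N" for N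
  have "0 \<le> v"
    by (rule tendsto_lowerbound[OF var])
       (intro always_eventually allI mult_nonneg_nonneg Bochner_Integration.integral_nonneg, auto)
  have sum: "char (distr M borel (\<lambda>\<omega>. \<Sum>k = 1..N. \<eta> N k \<omega>)) 1 = \<phi> N ^ N" for N
  proof -
    have "char (distr M borel (\<lambda>\<omega>. \<Sum>k = 1..N. \<eta> N k \<omega>)) 1
        = (\<Prod>k = 1..N. char (distr M borel (\<eta> N k)) 1)"
      by (rule char_distr_sum[OF indep])
    also have "\<dots> = (\<Prod>k = 1..N. \<phi> N)"
      unfolding \<phi>_def by (rule prod.cong[OF refl], subst ident, assumption, rule refl)
    finally show ?thesis by simp
  qed
  \<comment> \<open>The bound \<open>v / 4 \<le> N\<close> puts \<open>w N\<close> into the interval \<open>[-1, 1]\<close>.\<close>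
  have close: "cmod (\<phi> N ^ N - of_real (w N) ^ N)
      \<le> real N * q N + \<bar>real N * s N - v\<bar> / 2" if N: "1 \<le> N" "v / 4 \<le> real N" for N
  proof -
    interpret d: real_distribution "distr M borel (\<xi> N)"
      by (rule real_distribution_distr) simp
    have int: "integrable M (\<xi> N)"
      by (rule square_integrable_imp_integrable[OF _ square_integrable]) simp
    have "cmod (\<phi> N - (1 - 1\<^sup>2 * s N / 2))
        \<le> (1\<^sup>2 / 6) * expectation (\<lambda>\<omega>. min (6 * (\<xi> N \<omega>)\<^sup>2) (\<bar>1\<bar> * \<bar>\<xi> N \<omega>\<bar> ^ 3))"
      unfolding \<phi>_def
      by (rule char_approx3') (use int square_integrable mean in \<open>auto simp: s_def\<close>)
    also have "\<dots> \<le> (1 / 6) * (6 * q N)"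
    proof -
      have "expectation (\<lambda>\<omega>. min (6 * (\<xi> N \<omega>)\<^sup>2) (\<bar>1\<bar> * \<bar>\<xi> N \<omega>\<bar> ^ 3))
          \<le> expectation (\<lambda>\<omega>. 6 * \<bar>\<xi> N \<omega>\<bar> powr p)"
      proof (rule integral_mono)
        show "integrable M (\<lambda>\<omega>. 6 * \<bar>\<xi> N \<omega>\<bar> powr p)" using powr_integrable by simp
        show "integrable M (\<lambda>\<omega>. min (6 * (\<xi> N \<omega>)\<^sup>2) (\<bar>1\<bar> * \<bar>\<xi> N \<omega>\<bar> ^ 3))"
          by (rule Bochner_Integration.integrable_bound[of _ "\<lambda>\<omega>. 6 * (\<xi> N \<omega>)\<^sup>2"])
             (use square_integrable in auto)
      qed (use min_quadratic_cubic_le_powr[OF p] in simp)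
      then show ?thesis by (simp add: q_def)
    qed
    finally have 1: "cmod (\<phi> N - (1 - s N / 2)) \<le> q N" by simp
    have "cmod (\<phi> N ^ N - of_real (w N) ^ N) \<le> real N * cmod (\<phi> N - of_real (w N))"
    proof (rule norm_power_diff)
      show "cmod (\<phi> N) \<le> 1" unfolding \<phi>_def by (rule d.cmod_char_le_1)
      show "cmod (of_real (w N)) \<le> 1"
        using N \<open>0 \<le> v\<close> by (auto simp: w_def abs_le_iff field_simps simp del: of_real_add of_real_divide)
    qed
    also have "\<dots> \<le> real N * (q N + \<bar>s N - v / N\<bar> / 2)"
    proof (rule mult_left_mono)
      have "\<phi> N - of_real (w N) = (\<phi> N - (1 - s N / 2)) - of_real ((s N - v / N) / 2)"
        by (simp add: w_def field_simps)
      also have "cmod \<dots> \<le> cmod (\<phi> N - (1 - s N / 2)) + cmod (of_real ((s N - v / N) / 2))"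
        by (rule norm_triangle_ineq4)
      also have "\<dots> \<le> q N + \<bar>s N - v / N\<bar> / 2"
        using 1 unfolding norm_of_real by simp
      finally show "cmod (\<phi> N - of_real (w N)) \<le> q N + \<bar>s N - v / N\<bar> / 2" .
    qed simp
    also have "\<dots> = real N * q N + \<bar>real N * (s N - v / N)\<bar> / 2"
      by (simp add: distrib_left abs_mult)
    also have "real N * (s N - v / N) = real N * s N - v"
      using N by (simp add: field_simps)
    finally show ?thesis .
  qed
  have "(\<lambda>N. real N * q N + \<bar>real N * s N - v\<bar> / 2) \<longlonglongrightarrow> 0 + \<bar>v - v\<bar> / 2"
    unfolding s_def q_def by (intro tendsto_intros lyapunov var) simp
  then have lim0: "(\<lambda>N. real N * q N + \<bar>real N * s N - v\<bar> / 2) \<longlonglongrightarrow> 0" by simp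
  have "(\<lambda>N. \<phi> N ^ N - of_real (w N) ^ N) \<longlonglongrightarrow> 0"
  proof (rule Lim_null_comparison[OF _ lim0])
    show "\<forall>\<^sub>F N in sequentially. cmod (\<phi> N ^ N - of_real (w N) ^ N)
        \<le> real N * q N + \<bar>real N * s N - v\<bar> / 2"
      using eventually_ge_at_top[of "max 1 (nat \<lceil>v / 4\<rceil>)"]
      by eventually_elim (intro close, auto simp: nat_ceiling_le_eq)
  qed
  moreover have "(\<lambda>N. complex_of_real (w N ^ N)) \<longlonglongrightarrow> of_real (exp (- v / 2))"
    unfolding w_def by (intro tendsto_of_real tendsto_exp_limit_sequentially)
  ultimately have "(\<lambda>N. (\<phi> N ^ N - of_real (w N) ^ N) + complex_of_real (w N ^ N)) \<longlonglongrightarrow> 0 + of_real (exp (- v / 2))"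
    by (rule tendsto_add)
  then show ?thesis by (simp only: sum of_real_power diff_add_cancel add_0_left)
qed

section \<open>Moments of the exponential weights\<close>

locale standard_gaussian_pair = prob_space M for M :: "'a measure" +
  fixes X Y :: "'a \<Rightarrow> real" and \<rho> :: real
  assumes gaussian: "bivariate_gaussian M (\<lambda>\<omega>. (X \<omega>, Y \<omega>))"
    and mean: "expectation X = 0" "expectation Y = 0"
    and var: "variance X = 1" "variance Y = 1"
    and corr: "correlation X Y = \<rho>"
begin

lemma linear_gaussian: "gaussian_rv M (\<lambda>\<omega>. a * X \<omega> + b * Y \<omega>)"
  using gaussian by (simp add: bivariate_gaussian_def)

lemma measurable_X [measurable]: "X \<in> borel_measurable M"
  and measurable_Y [measurable]: "Y \<in> borel_measurable M"
  using linear_gaussian[of 1 0] linear_gaussian[of 0 1] by (auto simp: gaussian_rv_def)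

lemma integrable_second_moments:
  "integrable M (\<lambda>\<omega>. (X \<omega>)\<^sup>2)" "integrable M (\<lambda>\<omega>. (Y \<omega>)\<^sup>2)" "integrable M (\<lambda>\<omega>. X \<omega> * Y \<omega>)"
proof -
  show X: "integrable M (\<lambda>\<omega>. (X \<omega>)\<^sup>2)" and Y: "integrable M (\<lambda>\<omega>. (Y \<omega>)\<^sup>2)"
    using gaussian_rv_square_integrable[OF linear_gaussian[of 1 0]]
      gaussian_rv_square_integrable[OF linear_gaussian[of 0 1]] by simp_all
  have "\<bar>x * y\<bar> \<le> x\<^sup>2 + y\<^sup>2" for x y :: real
    using sum_squares_bound[of "\<bar>x\<bar>" "\<bar>y\<bar>"] abs_ge_zero[of "x * y"]
    unfolding abs_mult power2_abs by linarith
  then show "integrable M (\<lambda>\<omega>. X \<omega> * Y \<omega>)"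
    by (intro Bochner_Integration.integrable_bound[OF Bochner_Integration.integrable_add[OF X Y]]) auto
qed

lemma integrable_X: "integrable M X" and integrable_Y: "integrable M Y"
  by (rule square_integrable_imp_integrable; simp add: integrable_second_moments)+

lemma linear_mean: "expectation (\<lambda>\<omega>. a * X \<omega> + b * Y \<omega>) = 0"
  by (simp add: integrable_X integrable_Y mean)

lemma linear_variance: "variance (\<lambda>\<omega>. a * X \<omega> + b * Y \<omega>) = a\<^sup>2 + b\<^sup>2 + 2 * a * b * \<rho>"
proof -
  have "expectation (\<lambda>\<omega>. X \<omega> * Y \<omega>) = \<rho>"
    using corr var by (simp add: correlation_def covariance_def mean)
  moreover have "expectation (\<lambda>\<omega>. (X \<omega>)\<^sup>2) = 1" "expectation (\<lambda>\<omega>. (Y \<omega>)\<^sup>2) = 1"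
    using var by (simp_all add: mean)
  moreover have "(a * X \<omega> + b * Y \<omega>)\<^sup>2
      = a\<^sup>2 * (X \<omega>)\<^sup>2 + b\<^sup>2 * (Y \<omega>)\<^sup>2 + (2 * a * b) * (X \<omega> * Y \<omega>)" for \<omega>
    by (simp add: power2_eq_square algebra_simps)
  ultimately show ?thesis
    unfolding linear_mean by (simp add: integrable_second_moments)
qed

lemma exp_X:
  "integrable M (\<lambda>\<omega>. exp (c * X \<omega>))" "expectation (\<lambda>\<omega>. exp (c * X \<omega>)) = exp (c\<^sup>2 / 2)"
  using gaussian_rv_exp[OF linear_gaussian[of c 0]] linear_mean[of c 0] linear_variance[of c 0]
  by simp_all

lemma exp_mixed:
  "expectation (\<lambda>\<omega>. exp (of_real (a * X \<omega>) + \<i> * of_real (b * Y \<omega>)))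
   = exp (of_real ((a\<^sup>2 - b\<^sup>2) / 2) + \<i> * of_real (a * b * \<rho>))"
proof -
  have "expectation (\<lambda>\<omega>. exp (of_real a * of_real (X \<omega>) + \<i> * of_real (b * Y \<omega>)))
      = exp ((of_real a)\<^sup>2 / 2 + \<i> * of_real a * of_real (b * \<rho>) - of_real (b\<^sup>2 / 2))"
  proof (rule mixed_gaussian_transform[OF exp_X(1) measurable_X measurable_Y])
    show "expectation (\<lambda>\<omega>. iexp (c * X \<omega> + b * Y \<omega>)) = of_real (exp (- (c\<^sup>2 + b\<^sup>2 + 2 * c * b * \<rho>) / 2))" for c
      using gaussian_rv_iexp[OF linear_gaussian[of c b]]
      unfolding linear_variance unfolding linear_mean by (simp add: minus_divide_left)
  qed
  then show ?thesis by (simp add: diff_divide_distrib algebra_simps)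
qed

end

text \<open>
  In the next three definitions \<open>n\<close> stands for \<open>ln N\<close>: \<open>weight\<close> is a summand of the partition function,
  \<open>weight_mean\<close> is its expectation, and the denominator in \<open>increment\<close> is \<open>N powr (1/2 + \<sigma>\<^sup>2)\<close>.
\<close>
definition weight :: "real \<Rightarrow> real \<Rightarrow> real \<Rightarrow> real \<times> real \<Rightarrow> complex" where
  "weight \<sigma> \<tau> n v = exp (complex_of_real (sqrt n) *
     (complex_of_real (\<sigma> * fst v) + \<i> * complex_of_real (\<tau> * snd v)))"

lemma weight_measurable [measurable]: "weight \<sigma> \<tau> n \<in> borel_measurable borel"
  unfolding weight_def by (intro borel_measurable_continuous_onI continuous_intros)

lemma cmod_weight: "cmod (weight \<sigma> \<tau> n v) = exp (sqrt n * \<sigma> * fst v)"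
  by (simp add: weight_def mult_ac)

definition weight_mean :: "real \<Rightarrow> real \<Rightarrow> real \<Rightarrow> real \<Rightarrow> complex" where
  "weight_mean \<sigma> \<tau> \<rho> n = exp (of_real n * (of_real ((\<sigma>\<^sup>2 - \<tau>\<^sup>2) / 2) + \<i> * of_real (\<sigma> * \<tau> * \<rho>)))"

definition increment :: "real \<Rightarrow> real \<Rightarrow> real \<Rightarrow> real \<Rightarrow> real \<times> real \<Rightarrow> complex" where
  "increment \<sigma> \<tau> \<rho> n v = (weight \<sigma> \<tau> n v - weight_mean \<sigma> \<tau> \<rho> n) / of_real (exp (n * (1 / 2 + \<sigma>\<^sup>2)))"

lemma increment_measurable [measurable]: "increment \<sigma> \<tau> \<rho> n \<in> borel_measurable borel"
  unfolding increment_def by measurable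

text \<open>
  Splits the second moment of a complex variable in the direction \<open>u\<close> into an isotropic part and a part
  governed by the mean of \<open>z\<^sup>2\<close>; only the isotropic part survives in the limit.
\<close>
lemma inner_square_complex:
  "(u \<bullet> z)\<^sup>2 = ((cmod u)\<^sup>2 * (cmod z)\<^sup>2 + Re ((cnj u)\<^sup>2 * z\<^sup>2)) / 2"
  unfolding cmod_power2 inner_complex_def by (simp add: power2_eq_square algebra_simps)

lemma powr_add_le:
  fixes x y p :: real
  assumes "0 \<le> x" "0 \<le> y" "0 \<le> p"
  shows "(x + y) powr p \<le> 2 powr p * (x powr p + y powr p)"
proof -
  have "(x + y) powr p \<le> (2 * max x y) powr p"
    using assms by (intro powr_mono2) auto
  also have "\<dots> = 2 powr p * max x y powr p"
    using assms by (simp add: powr_mult)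
  also have "\<dots> \<le> 2 powr p * (x powr p + y powr p)"
    by (intro mult_left_mono) (auto simp: max_def)
  finally show ?thesis .
qed

context standard_gaussian_pair
begin

context
  fixes \<sigma> \<tau> n :: real
  assumes n: "0 \<le> n"
begin

abbreviation "W \<omega> \<equiv> weight \<sigma> \<tau> n (X \<omega>, Y \<omega>)"
abbreviation "m \<equiv> weight_mean \<sigma> \<tau> \<rho> n"
abbreviation "Z \<omega> \<equiv> increment \<sigma> \<tau> \<rho> n (X \<omega>, Y \<omega>)"

lemma weight_powr_moment:
  "integrable M (\<lambda>\<omega>. cmod (W \<omega>) powr p)"
  "expectation (\<lambda>\<omega>. cmod (W \<omega>) powr p) = exp (n * (p\<^sup>2 * \<sigma>\<^sup>2 / 2))"
proof -
  have eq: "cmod (W \<omega>) powr p = exp ((p * sqrt n * \<sigma>) * X \<omega>)" for \<omega>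
    by (simp add: cmod_weight powr_def mult_ac)
  show "integrable M (\<lambda>\<omega>. cmod (W \<omega>) powr p)"
    unfolding eq by (rule exp_X)
  show "expectation (\<lambda>\<omega>. cmod (W \<omega>) powr p) = exp (n * (p\<^sup>2 * \<sigma>\<^sup>2 / 2))"
    unfolding eq exp_X using n by (simp add: power_mult_distrib mult_ac)
qed

lemma weight_moments:
  "integrable M W" "expectation W = m"
  "integrable M (\<lambda>\<omega>. (W \<omega>)\<^sup>2)"
  "expectation (\<lambda>\<omega>. (W \<omega>)\<^sup>2) = exp (of_real n * (of_real (2 * (\<sigma>\<^sup>2 - \<tau>\<^sup>2)) + \<i> * of_real (4 * \<sigma> * \<tau> * \<rho>)))"
  "integrable M (\<lambda>\<omega>. (cmod (W \<omega>))\<^sup>2)"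
  "expectation (\<lambda>\<omega>. (cmod (W \<omega>))\<^sup>2) = exp (n * (2 * \<sigma>\<^sup>2))"
proof -
  have moment: "((k * sqrt n * \<sigma>)\<^sup>2 - (k * sqrt n * \<tau>)\<^sup>2) / 2 = n * (k\<^sup>2 * ((\<sigma>\<^sup>2 - \<tau>\<^sup>2) / 2))"
    "(k * sqrt n * \<sigma>) * (k * sqrt n * \<tau>) * \<rho> = n * (k\<^sup>2 * (\<sigma> * \<tau> * \<rho>))" for k
    using n by (simp_all add: power_mult_distrib power2_eq_square field_simps)
  have moment2: "2\<^sup>2 * ((\<sigma>\<^sup>2 - \<tau>\<^sup>2) / 2) = 2 * (\<sigma>\<^sup>2 - \<tau>\<^sup>2)" "2\<^sup>2 * (\<sigma> * \<tau> * \<rho>) = 4 * \<sigma> * \<tau> * \<rho>"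
    by simp_all
  have W: "W \<omega> = exp (of_real (1 * sqrt n * \<sigma> * X \<omega>) + \<i> * of_real (1 * sqrt n * \<tau> * Y \<omega>))" for \<omega>
    by (simp add: weight_def algebra_simps)
  have W2: "(W \<omega>)\<^sup>2 = exp (of_real (2 * sqrt n * \<sigma> * X \<omega>) + \<i> * of_real (2 * sqrt n * \<tau> * Y \<omega>))" for \<omega>
    unfolding W exp_double[symmetric] by (simp add: algebra_simps)
  show "integrable M (\<lambda>\<omega>. (cmod (W \<omega>))\<^sup>2)"
    using weight_powr_moment(1)[of 2] by (simp add: cmod_weight)
  then show "integrable M (\<lambda>\<omega>. (W \<omega>)\<^sup>2)"
    by (subst integrable_norm_iff[symmetric]) (simp_all add: norm_power)
  show "integrable M W"
    using weight_powr_moment(1)[of 1] by (subst integrable_norm_iff[symmetric]) simp_all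
  show "expectation (\<lambda>\<omega>. (cmod (W \<omega>))\<^sup>2) = exp (n * (2 * \<sigma>\<^sup>2))"
    using weight_powr_moment(2)[of 2] by (simp add: cmod_weight)
  show "expectation W = m"
    unfolding W exp_mixed moment by (simp add: weight_mean_def distrib_left mult_ac)
  show "expectation (\<lambda>\<omega>. (W \<omega>)\<^sup>2) = exp (of_real n * (of_real (2 * (\<sigma>\<^sup>2 - \<tau>\<^sup>2)) + \<i> * of_real (4 * \<sigma> * \<tau> * \<rho>)))"
    unfolding W2 exp_mixed moment moment2 by (simp add: distrib_left mult_ac)
qed

lemma increment_mean:
  "integrable M Z" "expectation Z = 0"
  unfolding increment_def using weight_moments(1,2) by (auto simp: prob_space)

text \<open>
  The factor \<open>exp n\<close> is the number \<open>N\<close> of summands. Both exponentials on the right decay as \<open>n\<close> grows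
  when \<open>\<tau> \<noteq> 0\<close>: the first comes from the mean of \<open>W\<^sup>2\<close>, the second from the square of the mean.
\<close>
lemma increment_square:
  "integrable M (\<lambda>\<omega>. (Z \<omega>)\<^sup>2)"
  "exp (of_real n) * expectation (\<lambda>\<omega>. (Z \<omega>)\<^sup>2) =
     exp (of_real n * (of_real (- 2 * \<tau>\<^sup>2) + \<i> * of_real (4 * \<sigma> * \<tau> * \<rho>)))
     - exp (of_real n * (of_real (- (\<sigma>\<^sup>2 + \<tau>\<^sup>2)) + \<i> * of_real (2 * \<sigma> * \<tau> * \<rho>)))"
  (is "_ = ?A - ?B")
proof -
  let ?a = "complex_of_real (exp (n * (1 / 2 + \<sigma>\<^sup>2)))"
  have eq: "(Z \<omega>)\<^sup>2 = ((W \<omega>)\<^sup>2 - 2 * m * W \<omega> + m\<^sup>2) / ?a\<^sup>2" for \<omega>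
    by (simp add: increment_def power_divide power2_diff mult_ac)
  show "integrable M (\<lambda>\<omega>. (Z \<omega>)\<^sup>2)"
    unfolding eq using weight_moments(1,3) by simp
  have a: "?a\<^sup>2 = exp (of_real n) * exp (of_real n * of_real (2 * \<sigma>\<^sup>2))"
    unfolding exp_of_real[symmetric] by (simp add: exp_add[symmetric] exp_double[symmetric] algebra_simps)
  have "expectation (\<lambda>\<omega>. (Z \<omega>)\<^sup>2) = (expectation (\<lambda>\<omega>. (W \<omega>)\<^sup>2) - m\<^sup>2) / ?a\<^sup>2"
    unfolding eq using weight_moments(1,2,3) by (simp add: prob_space power2_eq_square)
  also have "\<dots> = (?A - ?B) / exp (of_real n)"
    unfolding a weight_moments(4) weight_mean_def exp_double[symmetric]
    by (simp add: diff_divide_distrib exp_diff[symmetric] exp_add[symmetric] algebra_simps)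
  finally show "exp (of_real n) * expectation (\<lambda>\<omega>. (Z \<omega>)\<^sup>2) = ?A - ?B"
    by simp
qed

lemma increment_norm_square:
  "integrable M (\<lambda>\<omega>. (cmod (Z \<omega>))\<^sup>2)"
  "exp n * expectation (\<lambda>\<omega>. (cmod (Z \<omega>))\<^sup>2) = 1 - exp (- (n * (\<sigma>\<^sup>2 + \<tau>\<^sup>2)))"
proof -
  let ?a = "exp (n * (1 / 2 + \<sigma>\<^sup>2))"
  have eq: "(cmod (Z \<omega>))\<^sup>2 = ((cmod (W \<omega>))\<^sup>2 - 2 * Re (cnj m * W \<omega>) + (cmod m)\<^sup>2) / ?a\<^sup>2" for \<omega>
    by (simp add: increment_def norm_divide power_divide cmod_power2 power2_diff algebra_simps)
  show "integrable M (\<lambda>\<omega>. (cmod (Z \<omega>))\<^sup>2)"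
    unfolding eq using weight_moments(1,5) by simp
  have m: "(cmod m)\<^sup>2 = exp (n * (\<sigma>\<^sup>2 - \<tau>\<^sup>2))"
    by (simp add: weight_mean_def exp_double[symmetric])
  have a: "?a\<^sup>2 = exp n * exp (n * (2 * \<sigma>\<^sup>2))"
    by (simp add: exp_add[symmetric] exp_double[symmetric] algebra_simps)
  have "expectation (\<lambda>\<omega>. Re (cnj m * W \<omega>)) = Re (cnj m * m)"
    using weight_moments(1,2) by (subst integral_Re) auto
  also have "\<dots> = (cmod m)\<^sup>2"
    unfolding cmod_power2 by (simp add: power2_eq_square)
  finally have "expectation (\<lambda>\<omega>. (cmod (Z \<omega>))\<^sup>2) = (exp (n * (2 * \<sigma>\<^sup>2)) - (cmod m)\<^sup>2) / ?a\<^sup>2"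
    unfolding eq using weight_moments(1,5,6) by (simp add: prob_space)
  also have "\<dots> = (1 - exp (- (n * (\<sigma>\<^sup>2 + \<tau>\<^sup>2)))) / exp n"
    unfolding a m
    by (simp add: diff_divide_distrib exp_diff[symmetric] exp_minus[symmetric] exp_add[symmetric] inverse_eq_divide[symmetric] algebra_simps)
  finally show "exp n * expectation (\<lambda>\<omega>. (cmod (Z \<omega>))\<^sup>2) = 1 - exp (- (n * (\<sigma>\<^sup>2 + \<tau>\<^sup>2)))"
    by simp
qed

text \<open>
  By the exponential moments of \<open>X\<close>, the mean of \<open>\<bar>W\<bar> powr p\<close> is \<open>exp (n p\<^sup>2 \<sigma>\<^sup>2 / 2)\<close>, and \<open>\<bar>m\<bar> powr p\<close> is no
  larger. The exponent combines the factor \<open>N\<close>, this moment and the normalisation: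
  \<open>1 + p\<^sup>2 \<sigma>\<^sup>2 / 2 - p * (1/2 + \<sigma>\<^sup>2) = (p/2 - 1) * (p \<sigma>\<^sup>2 - 1)\<close>.
\<close>
lemma increment_powr_moment:
  assumes p: "1 \<le> p"
  shows "integrable M (\<lambda>\<omega>. \<bar>u \<bullet> Z \<omega>\<bar> powr p)"
    "exp n * expectation (\<lambda>\<omega>. \<bar>u \<bullet> Z \<omega>\<bar> powr p)
      \<le> 2 * (2 * cmod u) powr p * exp (n * ((p / 2 - 1) * (p * \<sigma>\<^sup>2 - 1)))"
proof -
  let ?a = "exp (n * (1 / 2 + \<sigma>\<^sup>2))"
  define K where "K = (2 * cmod u) powr p * exp (- (n * (p * (1 / 2 + \<sigma>\<^sup>2))))"
  have K: "0 \<le> K" by (simp add: K_def)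
  have bound: "\<bar>u \<bullet> Z \<omega>\<bar> powr p \<le> K * (cmod (W \<omega>) powr p + cmod m powr p)" for \<omega>
  proof -
    have "\<bar>u \<bullet> Z \<omega>\<bar> \<le> cmod u * cmod (Z \<omega>)"
      by (rule Cauchy_Schwarz_ineq2)
    also have "\<dots> \<le> (cmod u / ?a) * (cmod (W \<omega>) + cmod m)"
      using norm_triangle_ineq4[of "W \<omega>" m]
      by (simp add: increment_def norm_divide divide_right_mono mult_left_mono)
    finally have "\<bar>u \<bullet> Z \<omega>\<bar> powr p \<le> ((cmod u / ?a) * (cmod (W \<omega>) + cmod m)) powr p"
      using p by (intro powr_mono2) auto
    also have "\<dots> = (cmod u / ?a) powr p * (cmod (W \<omega>) + cmod m) powr p"
      by (subst powr_mult) auto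
    also have "\<dots> \<le> (cmod u / ?a) powr p * (2 powr p * (cmod (W \<omega>) powr p + cmod m powr p))"
      using p by (intro mult_left_mono powr_add_le) auto
    also have "\<dots> = K * (cmod (W \<omega>) powr p + cmod m powr p)"
      by (simp add: K_def powr_divide powr_mult exp_powr_real exp_minus field_simps)
    finally show ?thesis .
  qed
  have int: "integrable M (\<lambda>\<omega>. K * (cmod (W \<omega>) powr p + cmod m powr p))"
    using weight_powr_moment(1)[of p] by simp
  show int': "integrable M (\<lambda>\<omega>. \<bar>u \<bullet> Z \<omega>\<bar> powr p)"
    by (rule Bochner_Integration.integrable_bound[OF int]) (use bound K in auto)
  have "cmod m powr p = exp (n * (p * (\<sigma>\<^sup>2 - \<tau>\<^sup>2) / 2))"
    by (simp add: weight_mean_def exp_powr_real mult_ac)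
  also have "\<dots> \<le> exp (n * (p\<^sup>2 * \<sigma>\<^sup>2 / 2))"
  proof -
    have "p * (\<sigma>\<^sup>2 - \<tau>\<^sup>2) \<le> p * (p * \<sigma>\<^sup>2)"
    proof (rule mult_left_mono)
      have "1 * \<sigma>\<^sup>2 \<le> p * \<sigma>\<^sup>2" using p by (intro mult_right_mono) auto
      then show "\<sigma>\<^sup>2 - \<tau>\<^sup>2 \<le> p * \<sigma>\<^sup>2" by (smt (verit) zero_le_power2)
    qed (use p in simp)
    then have "p * (\<sigma>\<^sup>2 - \<tau>\<^sup>2) / 2 \<le> p\<^sup>2 * \<sigma>\<^sup>2 / 2" by (simp add: power2_eq_square)
    then show ?thesis using n by (simp add: mult_left_mono)
  qed
  finally have m: "cmod m powr p \<le> exp (n * (p\<^sup>2 * \<sigma>\<^sup>2 / 2))" .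
  have "expectation (\<lambda>\<omega>. \<bar>u \<bullet> Z \<omega>\<bar> powr p) \<le> expectation (\<lambda>\<omega>. K * (cmod (W \<omega>) powr p + cmod m powr p))"
    by (rule integral_mono[OF int' int bound])
  also have "\<dots> = K * (exp (n * (p\<^sup>2 * \<sigma>\<^sup>2 / 2)) + cmod m powr p)"
    using weight_powr_moment[of p] by (simp add: prob_space)
  also have "\<dots> \<le> K * (2 * exp (n * (p\<^sup>2 * \<sigma>\<^sup>2 / 2)))"
    using m K by (intro mult_left_mono) auto
  finally have "exp n * expectation (\<lambda>\<omega>. \<bar>u \<bullet> Z \<omega>\<bar> powr p) \<le> exp n * (K * (2 * exp (n * (p\<^sup>2 * \<sigma>\<^sup>2 / 2))))"
    by simp
  also have "\<dots> = 2 * (2 * cmod u) powr p *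
      (exp n * exp (- (n * (p * (1 / 2 + \<sigma>\<^sup>2)))) * exp (n * (p\<^sup>2 * \<sigma>\<^sup>2 / 2)))"
    by (simp add: K_def)
  also have "exp n * exp (- (n * (p * (1 / 2 + \<sigma>\<^sup>2)))) * exp (n * (p\<^sup>2 * \<sigma>\<^sup>2 / 2))
      = exp (n * ((p / 2 - 1) * (p * \<sigma>\<^sup>2 - 1)))"
    by (simp add: exp_add[symmetric] power2_eq_square algebra_simps)
  finally show "exp n * expectation (\<lambda>\<omega>. \<bar>u \<bullet> Z \<omega>\<bar> powr p)
      \<le> 2 * (2 * cmod u) powr p * exp (n * ((p / 2 - 1) * (p * \<sigma>\<^sup>2 - 1)))" .
qed

end

end

section \<open>Fluctuations of the partition function\<close>

lemma exp_ln_decay: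
  assumes "c < 0"
  shows "(\<lambda>N. exp (ln (real N) * c)) \<longlonglongrightarrow> 0"
  using assms by real_asymp

lemma complex_exp_ln_decay:
  assumes "c < 0"
  shows "(\<lambda>N. exp (of_real (ln (real N)) * (of_real c + \<i> * of_real d))) \<longlonglongrightarrow> 0"
  by (rule tendsto_norm_zero_cancel) (use exp_ln_decay[OF assms] in simp)

lemma (in standard_gaussian_pair) increment_inner_variance_tendsto:
  assumes "\<tau> \<noteq> 0"
  shows "(\<lambda>N. real N * expectation (\<lambda>\<omega>. (u \<bullet> increment \<sigma> \<tau> \<rho> (ln (real N)) (X \<omega>, Y \<omega>))\<^sup>2))
    \<longlonglongrightarrow> (cmod u)\<^sup>2 / 2"
proof -
  let ?n = "\<lambda>N. ln (real N)"
  let ?Z = "\<lambda>N \<omega>. increment \<sigma> \<tau> \<rho> (?n N) (X \<omega>, Y \<omega>)"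
  let ?A = "\<lambda>N. exp (of_real (?n N) * (of_real (- 2 * \<tau>\<^sup>2) + \<i> * of_real (4 * \<sigma> * \<tau> * \<rho>)))"
  let ?B = "\<lambda>N. exp (of_real (?n N) * (of_real (- (\<sigma>\<^sup>2 + \<tau>\<^sup>2)) + \<i> * of_real (2 * \<sigma> * \<tau> * \<rho>)))"
  let ?L = "\<lambda>N. ((cmod u)\<^sup>2 * (1 - exp (?n N * (- (\<sigma>\<^sup>2 + \<tau>\<^sup>2)))) + Re ((cnj u)\<^sup>2 * (?A N - ?B N))) / 2"
  have Re_scale: "Re (c * (of_real r * z)) = r * Re (c * z)" for c z r
    by (simp add: algebra_simps)
  have neg: "- 2 * \<tau>\<^sup>2 < 0" "- (\<sigma>\<^sup>2 + \<tau>\<^sup>2) < 0"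
    using assms sum_power2_gt_zero_iff[of \<sigma> \<tau>] by auto
  have "?L \<longlonglongrightarrow> ((cmod u)\<^sup>2 * (1 - 0) + Re ((cnj u)\<^sup>2 * (0 - 0))) / 2"
    by (intro tendsto_intros exp_ln_decay complex_exp_ln_decay neg) simp
  moreover have "\<forall>\<^sub>F N in sequentially. ?L N = real N * expectation (\<lambda>\<omega>. (u \<bullet> ?Z N \<omega>)\<^sup>2)"
    using eventually_gt_at_top[of 0]
  proof eventually_elim
    case (elim N)
    then have n: "0 \<le> ?n N" and N: "exp (?n N) = real N" by auto
    note sq = increment_square[OF n, of \<sigma> \<tau>] and norm = increment_norm_square[OF n, of \<sigma> \<tau>]
    have "expectation (\<lambda>\<omega>. (u \<bullet> ?Z N \<omega>)\<^sup>2)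
        = ((cmod u)\<^sup>2 * expectation (\<lambda>\<omega>. (cmod (?Z N \<omega>))\<^sup>2) + Re ((cnj u)\<^sup>2 * expectation (\<lambda>\<omega>. (?Z N \<omega>)\<^sup>2))) / 2"
      unfolding inner_square_complex using sq(1) norm(1) by simp
    then have "real N * expectation (\<lambda>\<omega>. (u \<bullet> ?Z N \<omega>)\<^sup>2)
        = ((cmod u)\<^sup>2 * (exp (?n N) * expectation (\<lambda>\<omega>. (cmod (?Z N \<omega>))\<^sup>2))
          + Re ((cnj u)\<^sup>2 * (exp (of_real (?n N)) * expectation (\<lambda>\<omega>. (?Z N \<omega>)\<^sup>2)))) / 2"
      unfolding N exp_of_real Re_scale by (simp add: field_simps del: times_complex.sel)
    also have "\<dots> = ?L N"
      unfolding sq(2) norm(2) by (simp add: algebra_simps)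
    finally show ?case by simp
  qed
  ultimately show ?thesis by (simp add: Lim_transform_eventually)
qed

lemma (in standard_gaussian_pair) increment_inner_lyapunov:
  assumes "2 < p" "p * \<sigma>\<^sup>2 < 1"
  shows "(\<lambda>N. real N * expectation (\<lambda>\<omega>. \<bar>u \<bullet> increment \<sigma> \<tau> \<rho> (ln (real N)) (X \<omega>, Y \<omega>)\<bar> powr p)) \<longlonglongrightarrow> 0"
proof -
  let ?n = "\<lambda>N. ln (real N)"
  let ?c = "(p / 2 - 1) * (p * \<sigma>\<^sup>2 - 1)"
  let ?E = "\<lambda>N. real N * expectation (\<lambda>\<omega>. \<bar>u \<bullet> increment \<sigma> \<tau> \<rho> (?n N) (X \<omega>, Y \<omega>)\<bar> powr p)"
  have "?c < 0" using assms by (intro mult_pos_neg) auto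
  then have lim: "(\<lambda>N. 2 * (2 * cmod u) powr p * exp (?n N * ?c)) \<longlonglongrightarrow> 0"
    by (intro tendsto_mult_right_zero exp_ln_decay)
  have upper: "\<forall>\<^sub>F N in sequentially. ?E N \<le> 2 * (2 * cmod u) powr p * exp (?n N * ?c)"
    using eventually_gt_at_top[of 0]
  proof eventually_elim
    case (elim N)
    then have n: "0 \<le> ?n N" and N: "exp (?n N) = real N" by auto
    show ?case
      using increment_powr_moment(2)[OF n, where p = p and \<sigma> = \<sigma> and \<tau> = \<tau> and u = u] assms(1) unfolding N by simp
  qed
  have lower: "\<forall>\<^sub>F N in sequentially. 0 \<le> ?E N"
    by (intro always_eventually allI mult_nonneg_nonneg Bochner_Integration.integral_nonneg) auto
  show ?thesis
    by (rule tendsto_sandwich[OF lower upper tendsto_const lim])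
qed

text \<open>
  The centring term is \<open>N\<close> times the mean weight, so it can be distributed over the summands. For \<open>N = 0\<close>
  the left-hand side is a division by \<open>0 powr _ = 0\<close> and both sides vanish.
\<close>
lemma normalised_partition_fun_eq:
  "(partition_fun X Y (\<sigma>, \<tau>) N \<omega>
        - of_nat N powr (1 + complex_of_real ((\<sigma>\<^sup>2 - \<tau>\<^sup>2) / 2) + \<i> * complex_of_real (\<sigma> * \<tau> * \<rho>)))
      / of_nat N powr complex_of_real (1 / 2 + \<sigma>\<^sup>2)
    = (\<Sum>k = 1..N. increment \<sigma> \<tau> \<rho> (ln (real N)) (X k \<omega>, Y k \<omega>))"
proof (cases "N = 0")
  case False
  define n where "n = ln (real N)"
  have N: "of_nat N powr z = exp (z * of_real n)" for z :: complex
    using False by (simp add: powr_def n_def Ln_of_nat)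
  have mean: "of_nat N powr (1 + complex_of_real ((\<sigma>\<^sup>2 - \<tau>\<^sup>2) / 2) + \<i> * complex_of_real (\<sigma> * \<tau> * \<rho>))
      = of_nat N * weight_mean \<sigma> \<tau> \<rho> n"
  proof -
    have "exp (complex_of_real n) = of_nat N"
      using False by (simp add: n_def exp_of_real)
    then show ?thesis
      unfolding N weight_mean_def
      by (simp add: exp_add distrib_right distrib_left mult_ac)
  qed
  have scale: "of_nat N powr complex_of_real (1 / 2 + \<sigma>\<^sup>2) = of_real (exp (n * (1 / 2 + \<sigma>\<^sup>2)))"
    unfolding N by (simp only: exp_of_real[symmetric] of_real_mult mult.commute)
  have "partition_fun X Y (\<sigma>, \<tau>) N \<omega> = (\<Sum>k = 1..N. weight \<sigma> \<tau> n (X k \<omega>, Y k \<omega>))"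
    by (simp add: partition_fun_def weight_def n_def)
  moreover have "of_nat N * weight_mean \<sigma> \<tau> \<rho> n = (\<Sum>k = 1..N. weight_mean \<sigma> \<tau> \<rho> n)"
    by simp
  ultimately show ?thesis
    unfolding mean scale increment_def n_def[symmetric]
    by (simp only: sum_subtractf[symmetric] sum_divide_distrib)
qed (simp add: partition_fun_def)

theorem theorem2p16:
  fixes M :: "'a measure" and X Y :: "nat \<Rightarrow> 'a \<Rightarrow> real" and \<rho> \<sigma> \<tau> :: real
  assumes "prob_space M"
    and "prob_space.iid_vars M (\<lambda>k \<omega>. (X k \<omega>, Y k \<omega>)) {1..}"
    and "\<And>k. k \<ge> 1 \<Longrightarrow> bivariate_gaussian M (\<lambda>\<omega>. (X k \<omega>, Y k \<omega>))"
    and "\<And>k. k \<ge> 1 \<Longrightarrow> prob_space.expectation M (X k) = 0"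
    and "\<And>k. k \<ge> 1 \<Longrightarrow> prob_space.expectation M (Y k) = 0"
    and "\<And>k. k \<ge> 1 \<Longrightarrow> prob_space.variance M (X k) = 1"
    and "\<And>k. k \<ge> 1 \<Longrightarrow> prob_space.variance M (Y k) = 1"
    and "\<And>k. k \<ge> 1 \<Longrightarrow> prob_space.correlation M (X k) (Y k) = \<rho>"
    and "-1 \<le> \<rho>" and "\<rho> \<le> 1"
    and "\<sigma>\<^sup>2 < 1 / 2" and "\<tau> \<noteq> 0"
  shows "conv_in_distribution M
    (\<lambda>N \<omega>. (partition_fun X Y (\<sigma>, \<tau>) N \<omega>
        - of_nat N powr (1 + complex_of_real ((\<sigma>\<^sup>2 - \<tau>\<^sup>2) / 2) + \<i> * complex_of_real (\<sigma> * \<tau> * \<rho>)))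
      / of_nat N powr complex_of_real (1 / 2 + \<sigma>\<^sup>2))
    (complex_normal 1)"
proof -
  interpret prob_space M by fact
  interpret G: standard_gaussian_pair M "X 1" "Y 1" \<rho>
  proof
    show "bivariate_gaussian M (\<lambda>\<omega>. (X 1 \<omega>, Y 1 \<omega>))" by (rule assms(3)) (rule order_refl)
    show "expectation (X 1) = 0" by (rule assms(4)) (rule order_refl)
    show "expectation (Y 1) = 0" by (rule assms(5)) (rule order_refl)
    show "variance (X 1) = 1" by (rule assms(6)) (rule order_refl)
    show "variance (Y 1) = 1" by (rule assms(7)) (rule order_refl)
    show "correlation (X 1) (Y 1) = \<rho>" by (rule assms(8)) (rule order_refl)
  qed
  define V where "V k \<omega> = (X k \<omega>, Y k \<omega>)" for k \<omega>
  define \<zeta> where "\<zeta> N = increment \<sigma> \<tau> \<rho> (ln (real N))" for N :: nat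
  define S where "S N \<omega> = (\<Sum>k = 1..N. \<zeta> N (V k \<omega>))" for N \<omega>
  have indep: "indep_vars (\<lambda>_. borel) V {1..}" and
    ident: "\<And>j k. 1 \<le> j \<Longrightarrow> 1 \<le> k \<Longrightarrow> distr M borel (V j) = distr M borel (V k)"
    using assms(2) unfolding iid_vars_def V_def[abs_def, symmetric] by blast+
  have V_measurable: "V k \<in> borel_measurable M" if "1 \<le> k" for k
    using indep that by (auto simp: indep_vars_def2)
  have \<zeta>_measurable [measurable]: "\<zeta> N \<in> borel_measurable borel" for N
    unfolding \<zeta>_def by (rule increment_measurable)
  have S_measurable [measurable]: "S N \<in> borel_measurable M" for N
    unfolding S_def
    by (intro borel_measurable_sum measurable_compose[OF V_measurable \<zeta>_measurable]) simp
  have \<zeta>_1: "\<zeta> N (V 1 \<omega>) = increment \<sigma> \<tau> \<rho> (ln (real N)) (X 1 \<omega>, Y 1 \<omega>)" for N \<omega>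
    by (simp add: \<zeta>_def V_def)
  have ln_nonneg: "0 \<le> ln (real N)" for N
    by (cases "N = 0") auto
  \<comment> \<open>A Lyapunov exponent: \<open>1 - p * \<sigma>\<^sup>2\<close> equals \<open>(\<sigma>\<^sup>2 - 2) * (\<sigma>\<^sup>2 - 1/2)\<close>, a product of negative numbers.\<close>
  define p where "p = 5 / 2 - \<sigma>\<^sup>2"
  have p: "2 < p" "p \<le> 3" "p * \<sigma>\<^sup>2 < 1"
  proof -
    show "2 < p" using assms(11) by (simp add: p_def)
    show "p \<le> 3" using zero_le_power2[of \<sigma>] unfolding p_def by linarith
    have "0 < (\<sigma>\<^sup>2 - 2) * (\<sigma>\<^sup>2 - 1 / 2)" using assms(11) by (intro mult_neg_neg) auto
    then show "p * \<sigma>\<^sup>2 < 1" by (simp add: p_def algebra_simps)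
  qed
  have char: "(\<lambda>N. CLINT z|distr M borel (S N). iexp (u \<bullet> z)) \<longlonglongrightarrow> (CLINT z|complex_normal 1. iexp (u \<bullet> z))" for u
  proof -
    have "(\<lambda>N. char (distr M borel (\<lambda>\<omega>. \<Sum>k = 1..N. u \<bullet> \<zeta> N (V k \<omega>))) 1)
        \<longlonglongrightarrow> of_real (exp (- ((cmod u)\<^sup>2 / 2) / 2))"
    proof (rule iid_array_char_tendsto[where \<xi> = "\<lambda>N \<omega>. u \<bullet> \<zeta> N (V 1 \<omega>)" and p = p])
      fix N :: nat
      have [measurable]: "V 1 \<in> borel_measurable M" by (rule V_measurable) simp
      show "indep_vars (\<lambda>_. borel) (\<lambda>k \<omega>. u \<bullet> \<zeta> N (V k \<omega>)) {1..N}"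
        by (rule indep_vars_compose2[OF indep_vars_subset[OF indep]]) auto
      show "distr M borel (\<lambda>\<omega>. u \<bullet> \<zeta> N (V k \<omega>)) = distr M borel (\<lambda>\<omega>. u \<bullet> \<zeta> N (V 1 \<omega>))"
        if "k \<in> {1..N}" for k
      proof -
        have "distr M borel (\<lambda>\<omega>. u \<bullet> \<zeta> N (V j \<omega>)) = distr (distr M borel (V j)) borel (\<lambda>v. u \<bullet> \<zeta> N v)"
          if "1 \<le> j" for j
          using V_measurable[OF that] by (subst distr_distr) (auto simp: comp_def)
        then show ?thesis using that ident[of k 1] by simp
      qed
      show "(\<lambda>\<omega>. u \<bullet> \<zeta> N (V 1 \<omega>)) \<in> borel_measurable M" by measurable
      show "integrable M (\<lambda>\<omega>. (u \<bullet> \<zeta> N (V 1 \<omega>))\<^sup>2)"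
        unfolding inner_square_complex \<zeta>_1
        using G.increment_square(1)[OF ln_nonneg] G.increment_norm_square(1)[OF ln_nonneg] by simp
      show "expectation (\<lambda>\<omega>. u \<bullet> \<zeta> N (V 1 \<omega>)) = 0"
        unfolding \<zeta>_1 using G.increment_mean[OF ln_nonneg[of N], where \<sigma> = \<sigma> and \<tau> = \<tau>] by simp
      show "integrable M (\<lambda>\<omega>. \<bar>u \<bullet> \<zeta> N (V 1 \<omega>)\<bar> powr p)"
        unfolding \<zeta>_1 using p(1) by (intro G.increment_powr_moment(1) ln_nonneg) simp
    next
      show "(\<lambda>N. real N * expectation (\<lambda>\<omega>. (u \<bullet> \<zeta> N (V 1 \<omega>))\<^sup>2)) \<longlonglongrightarrow> (cmod u)\<^sup>2 / 2"
        unfolding \<zeta>_1 by (rule G.increment_inner_variance_tendsto) fact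
      show "(\<lambda>N. real N * expectation (\<lambda>\<omega>. \<bar>u \<bullet> \<zeta> N (V 1 \<omega>)\<bar> powr p)) \<longlonglongrightarrow> 0"
        unfolding \<zeta>_1 by (rule G.increment_inner_lyapunov[OF p(1,3)])
    qed (rule p)+
    moreover have "char (distr M borel (\<lambda>\<omega>. \<Sum>k = 1..N. u \<bullet> \<zeta> N (V k \<omega>))) 1
        = (CLINT z|distr M borel (S N). iexp (u \<bullet> z))" for N
    proof -
      have eq: "(\<lambda>\<omega>. \<Sum>k = 1..N. u \<bullet> \<zeta> N (V k \<omega>)) = (\<lambda>\<omega>. u \<bullet> S N \<omega>)"
        by (simp add: S_def inner_sum_right)
      show ?thesis unfolding eq char_def by (simp add: integral_distr)
    qed
    ultimately show ?thesis by (simp add: char_complex_normal)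
  qed
  have "weak_conv_bc (\<lambda>N. distr M borel (S N)) (complex_normal 1)"
  proof (rule complex_levy_continuity[OF _ _ prob_space_complex_normal _ char])
    show "prob_space (distr M borel (S N))" for N
      by (rule prob_space_distr) measurable
  qed (simp_all add: complex_normal_def)
  then have "conv_in_distribution M S (complex_normal 1)"
    by (simp add: conv_in_distribution_def S_measurable)
  also have "S = (\<lambda>N \<omega>. (partition_fun X Y (\<sigma>, \<tau>) N \<omega>
        - of_nat N powr (1 + complex_of_real ((\<sigma>\<^sup>2 - \<tau>\<^sup>2) / 2) + \<i> * complex_of_real (\<sigma> * \<tau> * \<rho>)))
      / of_nat N powr complex_of_real (1 / 2 + \<sigma>\<^sup>2))"
    unfolding normalised_partition_fun_eq by (simp add: S_def[abs_def] \<zeta>_def V_def)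
  finally show ?thesis .
qed

end
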